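(* Let $\mathcal{M}$ be an infinite structure and $(I,<)$ any linear order. Then there is a proper elementary extension $\mathcal{M}^\ast$ of $\mathcal{M}$ and a group embedding $\alpha\mapsto\widehat{\alpha}$ from $\mathrm{Aut}(I,<)$ into $\mathrm{Aut}(\mathcal{M}^\ast)$ such that $\widehat{\alpha}$ moves every element of $M^\ast\setminus M$ and fixes every element of $M$ whenever $\alpha$ is fixed point free.
   Context: $\mathrm{Aut}(\mathcal{S})$ denotes the automorphism group of a structure $\mathcal{S}$; $\mathrm{Aut}(I,<)$ is the group of order-automorphisms of $(I,<)$. An automorphism $\alpha$ of $(I,<)$ is fixed point free if $\alpha(i)\neq i$ for all $i\in I$.
   Formalization: The linear order (I,<) is assumed nonempty; for empty I the identity is vacuously fixed point free, yet its image is the identity and cannot move the elements of the nonempty set M*\M, so the claim fails there. *)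

theory Defs
  imports "HOL-Algebra.Bij"
begin

section \<open>First-order structures\<close>

text \<open>
  A language is given by sets of function and relation symbols with their arities; constant symbols
  are function symbols of arity 0.  Equality is a logical symbol.
\<close>

record ('f, 'r) language =
  fun_syms :: "'f set"
  fun_arity :: "'f \<Rightarrow> nat"
  rel_syms :: "'r set"
  rel_arity :: "'r \<Rightarrow> nat"

record ('f, 'r, 'a) fo_struct =
  universe :: "'a set"
  fun_int :: "'f \<Rightarrow> 'a list \<Rightarrow> 'a"
  rel_int :: "'r \<Rightarrow> 'a list \<Rightarrow> bool"

definition tuples :: "'a set \<Rightarrow> nat \<Rightarrow> 'a list set" where
  "tuples A n = {xs. set xs \<subseteq> A \<and> length xs = n}"

definition is_struct :: "('f, 'r) language \<Rightarrow> ('f, 'r, 'a) fo_struct \<Rightarrow> bool" where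
  "is_struct L M \<longleftrightarrow> universe M \<noteq> {} \<and>
     (\<forall>f\<in>fun_syms L. \<forall>xs\<in>tuples (universe M) (fun_arity L f). fun_int M f xs \<in> universe M)"

datatype 'f trm = Var nat | Fn 'f "'f trm list"

datatype ('f, 'r) fm =
    Eq "'f trm" "'f trm"
  | Rel 'r "'f trm list"
  | Neg "('f, 'r) fm"
  | Conj "('f, 'r) fm" "('f, 'r) fm"
  | Ex nat "('f, 'r) fm"

fun is_trm :: "('f, 'r) language \<Rightarrow> 'f trm \<Rightarrow> bool" where
  "is_trm L (Var n) \<longleftrightarrow> True"
| "is_trm L (Fn f ts) \<longleftrightarrow>
     f \<in> fun_syms L \<and> length ts = fun_arity L f \<and> (\<forall>t\<in>set ts. is_trm L t)"

fun is_fm :: "('f, 'r) language \<Rightarrow> ('f, 'r) fm \<Rightarrow> bool" where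
  "is_fm L (Eq s t) \<longleftrightarrow> is_trm L s \<and> is_trm L t"
| "is_fm L (Rel r ts) \<longleftrightarrow>
     r \<in> rel_syms L \<and> length ts = rel_arity L r \<and> (\<forall>t\<in>set ts. is_trm L t)"
| "is_fm L (Neg p) \<longleftrightarrow> is_fm L p"
| "is_fm L (Conj p q) \<longleftrightarrow> is_fm L p \<and> is_fm L q"
| "is_fm L (Ex n p) \<longleftrightarrow> is_fm L p"

fun eval :: "('f, 'r, 'a) fo_struct \<Rightarrow> (nat \<Rightarrow> 'a) \<Rightarrow> 'f trm \<Rightarrow> 'a" where
  "eval M e (Var n) = e n"
| "eval M e (Fn f ts) = fun_int M f (map (eval M e) ts)"

fun sat :: "('f, 'r, 'a) fo_struct \<Rightarrow> (nat \<Rightarrow> 'a) \<Rightarrow> ('f, 'r) fm \<Rightarrow> bool" where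
  "sat M e (Eq s t) \<longleftrightarrow> eval M e s = eval M e t"
| "sat M e (Rel r ts) \<longleftrightarrow> rel_int M r (map (eval M e) ts)"
| "sat M e (Neg p) \<longleftrightarrow> \<not> sat M e p"
| "sat M e (Conj p q) \<longleftrightarrow> sat M e p \<and> sat M e q"
| "sat M e (Ex n p) \<longleftrightarrow> (\<exists>a\<in>universe M. sat M (e(n := a)) p)"


section \<open>Elementary extensions\<close>

definition substruct ::
    "('f, 'r) language \<Rightarrow> ('f, 'r, 'a) fo_struct \<Rightarrow> ('f, 'r, 'a) fo_struct \<Rightarrow> bool" where
  "substruct L M N \<longleftrightarrow> is_struct L M \<and> is_struct L N \<and> universe M \<subseteq> universe N \<and>
     (\<forall>f\<in>fun_syms L. \<forall>xs\<in>tuples (universe M) (fun_arity L f). fun_int M f xs = fun_int N f xs) \<and>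
     (\<forall>r\<in>rel_syms L. \<forall>xs\<in>tuples (universe M) (rel_arity L r). rel_int M r xs \<longleftrightarrow> rel_int N r xs)"

definition elem_extension ::
    "('f, 'r) language \<Rightarrow> ('f, 'r, 'a) fo_struct \<Rightarrow> ('f, 'r, 'a) fo_struct \<Rightarrow> bool" where
  "elem_extension L M N \<longleftrightarrow> substruct L M N \<and>
     (\<forall>p e. is_fm L p \<and> range e \<subseteq> universe M \<longrightarrow> (sat M e p \<longleftrightarrow> sat N e p))"

definition proper_elem_extension ::
    "('f, 'r) language \<Rightarrow> ('f, 'r, 'a) fo_struct \<Rightarrow> ('f, 'r, 'a) fo_struct \<Rightarrow> bool" where
  "proper_elem_extension L M N \<longleftrightarrow> elem_extension L M N \<and> universe M \<noteq> universe N"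

text \<open>
  The copy of a structure obtained by renaming its elements along an injection \<open>j\<close>.  It is used with
  \<open>j = Inl\<close> only, to view a structure over the type \<open>'m\<close> as a structure over a larger type in which
  there is room for a proper extension.
\<close>

definition struct_copy ::
    "('a \<Rightarrow> 'b) \<Rightarrow> ('f, 'r, 'a) fo_struct \<Rightarrow> ('f, 'r, 'b) fo_struct" where
  "struct_copy j M =
     \<lparr>universe = j ` universe M,
      fun_int = \<lambda>f ys. j (fun_int M f (map (inv_into (universe M) j) ys)),
      rel_int = \<lambda>r ys. rel_int M r (map (inv_into (universe M) j) ys)\<rparr>"

lemma struct_copy_simps [simp]:
  "universe (struct_copy j M) = j ` universe M"
  "fun_int (struct_copy j M) f ys = j (fun_int M f (map (inv_into (universe M) j) ys))"
  "rel_int (struct_copy j M) r ys = rel_int M r (map (inv_into (universe M) j) ys)"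
  by (simp_all add: struct_copy_def)

lemma eval_struct_copy:
  assumes M: "is_struct L M" and j: "inj_on j (universe M)"
    and t: "is_trm L t" and e: "range e \<subseteq> universe M"
  shows "eval M e t \<in> universe M \<and> eval (struct_copy j M) (\<lambda>k. j (e k)) t = j (eval M e t)"
  using t
proof (induction t)
  case (Var n)
  then show ?case using e by auto
next
  case (Fn f ts)
  then have IH: "\<And>t. t \<in> set ts \<Longrightarrow> eval M e t \<in> universe M"
      "\<And>t. t \<in> set ts \<Longrightarrow> eval (struct_copy j M) (\<lambda>k. j (e k)) t = j (eval M e t)"
    by auto
  have "map (eval M e) ts \<in> tuples (universe M) (fun_arity L f)"
    using Fn.prems IH by (auto simp: tuples_def)
  moreover have "map (inv_into (universe M) j) (map (eval (struct_copy j M) (\<lambda>k. j (e k))) ts)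
      = map (eval M e) ts"
    using IH j by simp
  ultimately show ?case
    using Fn.prems M by (simp add: is_struct_def del: map_map)
qed

lemma sat_struct_copy:
  assumes M: "is_struct L M" and j: "inj_on j (universe M)"
    and p: "is_fm L p" and e: "range e \<subseteq> universe M"
  shows "sat (struct_copy j M) (\<lambda>k. j (e k)) p \<longleftrightarrow> sat M e p"
  using p e
proof (induction p arbitrary: e)
  case (Eq s t)
  then show ?case
    using eval_struct_copy[OF M j, of s e] eval_struct_copy[OF M j, of t e] j
    by (auto dest: inj_onD)
next
  case (Rel r ts)
  then have "map (inv_into (universe M) j) (map (eval (struct_copy j M) (\<lambda>k. j (e k))) ts)
      = map (eval M e) ts"
    using eval_struct_copy[OF M j] j by simp
  then show ?case by (simp del: map_map)
next
  case (Ex n p)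
  have "sat (struct_copy j M) ((\<lambda>k. j (e k))(n := j a)) p \<longleftrightarrow> sat M (e(n := a)) p"
    if "a \<in> universe M" for a
  proof -
    have "range (e(n := a)) \<subseteq> universe M" using Ex.prems that by auto
    moreover have "(\<lambda>k. j (e k))(n := j a) = (\<lambda>k. j ((e(n := a)) k))" by auto
    ultimately show ?thesis using Ex.IH[of "e(n := a)"] Ex.prems(1) by (simp del: fun_upd_apply)
  qed
  then show ?case by simp
qed auto


section \<open>Automorphism groups\<close>

definition automorphisms :: "('f, 'r) language \<Rightarrow> ('f, 'r, 'a) fo_struct \<Rightarrow> ('a \<Rightarrow> 'a) set" where
  "automorphisms L M = {g \<in> Bij (universe M).
     (\<forall>f\<in>fun_syms L. \<forall>xs\<in>tuples (universe M) (fun_arity L f).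
        g (fun_int M f xs) = fun_int M f (map g xs)) \<and>
     (\<forall>r\<in>rel_syms L. \<forall>xs\<in>tuples (universe M) (rel_arity L r).
        rel_int M r xs \<longleftrightarrow> rel_int M r (map g xs))}"

definition Aut :: "('f, 'r) language \<Rightarrow> ('f, 'r, 'a) fo_struct \<Rightarrow> ('a \<Rightarrow> 'a) monoid" where
  "Aut L M = BijGroup (universe M) \<lparr>carrier := automorphisms L M\<rparr>"

definition order_automorphisms :: "'i set \<Rightarrow> 'i rel \<Rightarrow> ('i \<Rightarrow> 'i) set" where
  "order_automorphisms I r =
     {g \<in> Bij I. \<forall>i\<in>I. \<forall>j\<in>I. (i, j) \<in> r \<longleftrightarrow> (g i, g j) \<in> r}"

definition Aut_order :: "'i set \<Rightarrow> 'i rel \<Rightarrow> ('i \<Rightarrow> 'i) monoid" where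
  "Aut_order I r = BijGroup I \<lparr>carrier := order_automorphisms I r\<rparr>"

definition fixed_point_free :: "'i set \<Rightarrow> ('i \<Rightarrow> 'i) \<Rightarrow> bool" where
  "fixed_point_free I g \<longleftrightarrow> (\<forall>i\<in>I. g i \<noteq> i)"

text \<open>
  HOL cannot quantify existentially over types, so an extension of a structure over \<open>'m\<close> has to be
  sought over a specific type that is large enough.  The second summand below has room for the
  elements of an ultrapower of the structure over an ultrafilter on the natural numbers, iterated
  along a linear order on a subset of \<open>'i\<close>.
\<close>

type_synonym ('i, 'm) ambient = "'m + (('i \<Rightarrow> nat) \<Rightarrow> 'm)"

lemma group_Bij_subset:
  assumes sub: "A \<subseteq> Bij S" and one: "(\<lambda>x\<in>S. x) \<in> A"
    and comp: "\<And>g h. g \<in> A \<Longrightarrow> h \<in> A \<Longrightarrow> compose S g h \<in> A"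
    and inv: "\<And>g. g \<in> A \<Longrightarrow> (\<lambda>x\<in>S. inv_into S g x) \<in> A"
  shows "group (BijGroup S \<lparr>carrier := A\<rparr>)"
proof (rule subgroup.subgroup_is_group[OF _ group_BijGroup], rule subgroup.intro)
  show "A \<subseteq> carrier (BijGroup S)" using sub by (simp add: BijGroup_def)
  show "x \<otimes>\<^bsub>BijGroup S\<^esub> y \<in> A" if "x \<in> A" "y \<in> A" for x y
    using that sub comp by (auto simp: BijGroup_def subset_iff)
  show "\<one>\<^bsub>BijGroup S\<^esub> \<in> A" using one by (simp add: BijGroup_def)
  show "inv\<^bsub>BijGroup S\<^esub> x \<in> A" if "x \<in> A" for x
    using that sub inv by (simp add: inv_BijGroup subset_iff)
qed

lemma group_Aut_order: "group (Aut_order I r)"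
  unfolding Aut_order_def
proof (rule group_Bij_subset)
  show "order_automorphisms I r \<subseteq> Bij I" by (auto simp: order_automorphisms_def)
  show "(\<lambda>x\<in>I. x) \<in> order_automorphisms I r"
    by (auto simp: order_automorphisms_def id_Bij)
  show "compose I g h \<in> order_automorphisms I r"
    if "g \<in> order_automorphisms I r" "h \<in> order_automorphisms I r" for g h
  proof -
    have "h \<in> I \<rightarrow> I" using that by (auto simp: order_automorphisms_def dest: Bij_imp_funcset)
    then show ?thesis
      using that by (auto simp: order_automorphisms_def compose_Bij compose_eq Pi_iff)
  qed
  show "(\<lambda>x\<in>I. inv_into I g x) \<in> order_automorphisms I r"
    if g: "g \<in> order_automorphisms I r" for g
  proof -
    have B: "g \<in> Bij I" using g by (simp add: order_automorphisms_def)
    then have s: "g ` I = I" by (simp add: Bij_def bij_betw_def)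
    have "inv_into I g x \<in> I" "g (inv_into I g x) = x" if "x \<in> I" for x
      using that s by (auto intro: inv_into_into f_inv_into_f)
    then show ?thesis
      using g restrict_inv_into_Bij[OF B] by (auto simp: order_automorphisms_def)
  qed
qed

lemma group_Aut:
  assumes M: "is_struct L M"
  shows "group (Aut L M)"
  unfolding Aut_def
proof (rule group_Bij_subset)
  let ?U = "universe M"
  show "automorphisms L M \<subseteq> Bij ?U" by (auto simp: automorphisms_def)
  have clos: "fun_int M f xs \<in> ?U" if "f \<in> fun_syms L" "xs \<in> tuples ?U (fun_arity L f)" for f xs
    using M that by (simp add: is_struct_def)
  have id: "map (\<lambda>x\<in>?U. x) xs = xs" if "xs \<in> tuples ?U n" for xs n
    using that by (auto simp: tuples_def subset_iff intro: map_idI)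
  show "(\<lambda>x\<in>?U. x) \<in> automorphisms L M"
    using clos id by (auto simp: automorphisms_def id_Bij)
  show "compose ?U g h \<in> automorphisms L M"
    if g: "g \<in> automorphisms L M" and h: "h \<in> automorphisms L M" for g h
  proof -
    have B: "g \<in> Bij ?U" "h \<in> Bij ?U" using g h by (auto simp: automorphisms_def)
    then have hU: "h x \<in> ?U" if "x \<in> ?U" for x using that Bij_imp_funcset by blast
    have m: "map (compose ?U g h) xs = map g (map h xs)" "map h xs \<in> tuples ?U n"
      if "xs \<in> tuples ?U n" for xs n
      using that hU by (auto simp: tuples_def compose_eq subset_iff)
    show ?thesis
      using g h clos m(2) compose_Bij[OF B]
      by (auto simp: automorphisms_def m(1) compose_eq simp del: map_map)
  qed
  show "(\<lambda>x\<in>?U. inv_into ?U g x) \<in> automorphisms L M"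
    if g: "g \<in> automorphisms L M" for g
  proof -
    let ?k = "\<lambda>x\<in>?U. inv_into ?U g x"
    have B: "g \<in> Bij ?U" using g by (simp add: automorphisms_def)
    then have s: "g ` ?U = ?U" and i: "inj_on g ?U" by (auto simp: Bij_def bij_betw_def)
    have k: "?k x \<in> ?U" "g (?k x) = x" if "x \<in> ?U" for x
      using that s by (auto intro: inv_into_into f_inv_into_f)
    have m: "map ?k xs \<in> tuples ?U n" "map g (map ?k xs) = xs" if "xs \<in> tuples ?U n" for xs n
    proof -
      show "map ?k xs \<in> tuples ?U n" using that k(1) by (auto simp: tuples_def)
      have "\<forall>x\<in>set xs. g (?k x) = x" using that k(2) by (auto simp: tuples_def)
      then show "map g (map ?k xs) = xs" by (simp only: map_map) (simp add: map_idI)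
    qed
    have "?k (fun_int M f xs) = fun_int M f (map ?k xs)"
      if f: "f \<in> fun_syms L" and xs: "xs \<in> tuples ?U (fun_arity L f)" for f xs
    proof (rule inj_onD[OF i])
      have "g (fun_int M f (map ?k xs)) = fun_int M f (map g (map ?k xs))"
        using g f m(1)[OF xs] unfolding automorphisms_def by blast
      then show "g (?k (fun_int M f xs)) = g (fun_int M f (map ?k xs))"
        using k(2)[OF clos[OF f xs]] m(2)[OF xs] by simp
    qed (use k(1) clos f xs m(1) in blast)+
    moreover have "rel_int M r xs \<longleftrightarrow> rel_int M r (map ?k xs)"
      if r: "r \<in> rel_syms L" and xs: "xs \<in> tuples ?U (rel_arity L r)" for r xs
    proof -
      have "rel_int M r (map ?k xs) \<longleftrightarrow> rel_int M r (map g (map ?k xs))"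
        using g r m(1)[OF xs] unfolding automorphisms_def by blast
      then show ?thesis using m(2)[OF xs] by simp
    qed
    ultimately show ?thesis
      using restrict_inv_into_Bij[OF B] unfolding automorphisms_def by blast
  qed
qed

end

theory Submission
  imports Defs
begin

text \<open>
  Iterate the ultrapower of \<open>M\<close> by a free ultrafilter on the naturals along \<open>I\<close>: the elements are
  functions on \<open>I \<Rightarrow> nat\<close> that depend on finitely many coordinates, two of them being identified if
  they agree almost everywhere, where ``almost everywhere'' quantifies over the relevant coordinates
  one by one in the order of \<open>I\<close>.  An automorphism of \<open>I\<close> acts by permuting coordinates.  If two
  functions agree almost everywhere then they agree almost everywhere with a function that depends
  only on their common coordinates, so each class has a least support; a class fixed by \<open>\<alpha>\<close> has a
  support that is invariant under \<open>\<alpha>\<close> and finite, hence fixed pointwise.  If \<open>\<alpha>\<close> is fixed point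
  free, this support is empty and the class is that of a constant.
\<close>


section \<open>Free ultrafilters\<close>

text \<open>In the order of filters a smaller filter has more eventual properties, so lying below
  \<open>cofinite\<close> says that every cofinite set is large.\<close>

definition free_ultrafilter :: "'a filter \<Rightarrow> bool" where
  "free_ultrafilter U \<longleftrightarrow> U \<noteq> bot \<and> U \<le> cofinite \<and>
     (\<forall>P. eventually P U \<or> eventually (\<lambda>x. \<not> P x) U)"

lemma free_ultrafilter_not:
  assumes "free_ultrafilter U"
  shows "eventually (\<lambda>x. \<not> P x) U \<longleftrightarrow> \<not> eventually P U"
proof -
  have "\<not> (eventually P U \<and> eventually (\<lambda>x. \<not> P x) U)"
  proof
    assume "eventually P U \<and> eventually (\<lambda>x. \<not> P x) U"
    then have "eventually (\<lambda>x. P x \<and> \<not> P x) U" unfolding eventually_conj_iff .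
    then show False using assms by (simp add: free_ultrafilter_def eventually_False)
  qed
  then show ?thesis using assms by (auto simp: free_ultrafilter_def)
qed

lemma free_ultrafilter_const:
  assumes "free_ultrafilter U"
  shows "eventually (\<lambda>_. c) U \<longleftrightarrow> c"
  using assms by (cases c) (auto simp: free_ultrafilter_def eventually_False)

lemma free_ultrafilter_neq:
  assumes "free_ultrafilter U"
  shows "eventually (\<lambda>x. x \<noteq> a) U"
proof -
  have "eventually (\<lambda>x. x \<noteq> a) cofinite" by (simp add: eventually_cofinite)
  then show ?thesis using assms unfolding free_ultrafilter_def le_filter_def by blast
qed

text \<open>Zorn's lemma yields a minimal element among the proper filters below
  \<open>cofinite\<close>; minimality lets it decide every predicate.\<close>

lemma free_ultrafilter_exists:
  assumes "infinite (UNIV :: 'a set)"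
  shows "\<exists>U :: 'a filter. free_ultrafilter U"
proof -
  define A where "A = {F :: 'a filter. F \<noteq> bot \<and> F \<le> cofinite}"
  have "\<exists>m\<in>A. \<forall>a\<in>A. a \<le> m \<longrightarrow> a = m"
  proof (rule predicate_Zorn)
    show "partial_order_on A (relation_of (\<lambda>x y. y \<le> x) A)"
      by (rule partial_order_on_relation_ofI) auto
    fix C assume C: "C \<in> Chains (relation_of (\<lambda>x y. y \<le> x) A)"
    then have CA: "C \<subseteq> A" and tot: "\<And>x y. x \<in> C \<Longrightarrow> y \<in> C \<Longrightarrow> x \<le> y \<or> y \<le> x"
      unfolding Chains_def relation_of_def by blast+
    show "\<exists>u\<in>A. \<forall>a\<in>C. u \<le> a"
    proof (cases "C = {}")
      case True
      \<comment> \<open>The empty chain is bounded by \<open>cofinite\<close>, which is proper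
        because the type is infinite.\<close>
      have "\<not> eventually (\<lambda>_. False) (cofinite :: 'a filter)"
        using assms by (simp add: eventually_cofinite del: eventually_False)
      then have "cofinite \<in> A" by (simp add: A_def trivial_limit_def del: eventually_False)
      with True show ?thesis by blast
    next
      case False
      \<comment> \<open>A nonempty chain is directed, so a property that is eventual for
        \<open>Inf C\<close> is already eventual for a member of \<open>C\<close>.\<close>
      have "\<not> eventually (\<lambda>_. False) (Inf C)"
      proof
        assume "eventually (\<lambda>_. False) (Inf C)"
        moreover have dir: "\<exists>x\<in>C. x \<le> inf a b" if "a \<in> C" "b \<in> C" for a b
          using tot[OF that] that by (metis inf.absorb1 inf.absorb2 order_refl)
        ultimately have "\<exists>F\<in>C. eventually (\<lambda>_. False) F"
          using eventually_Inf_base[OF False dir] by simp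
        then obtain F where "F \<in> C" "eventually (\<lambda>_. False) F" by blast
        then show False using CA by (auto simp: A_def eventually_False)
      qed
      moreover have "Inf C \<le> cofinite"
        using False CA by (metis (mono_tags, lifting) A_def Inf_lower2 ex_in_conv mem_Collect_eq subsetD)
      ultimately have "Inf C \<in> A" by (simp add: A_def eventually_False)
      then show ?thesis by (auto intro: Inf_lower)
    qed
  qed
  then obtain U where U: "U \<in> A" and min: "\<And>F. F \<in> A \<Longrightarrow> F \<le> U \<Longrightarrow> F = U" by blast
  have "eventually P U" if "\<not> eventually (\<lambda>x. \<not> P x) U" for P
  proof -
    \<comment> \<open>Adjoining the set of \<open>P\<close> keeps the filter proper, since the
      negation of \<open>P\<close> is not eventual; by minimality the set was already large.\<close>
    let ?F = "inf U (principal {x. P x})"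
    have "?F \<noteq> bot"
      using that unfolding trivial_limit_def eventually_inf_principal by simp
    moreover have "?F \<le> cofinite" using U by (auto simp: A_def intro: le_infI1)
    ultimately have "?F = U" using min[of ?F] by (auto simp: A_def)
    moreover have "eventually P ?F" by (simp add: eventually_inf_principal)
    ultimately show ?thesis by simp
  qed
  then show ?thesis using U unfolding free_ultrafilter_def A_def by blast
qed


section \<open>Iterated quantification over finitely many coordinates\<close>

definition depends_on :: "'i set \<Rightarrow> (('i \<Rightarrow> 'n) \<Rightarrow> 'b) \<Rightarrow> bool" where
  "depends_on A f \<longleftrightarrow> (\<forall>s t. (\<forall>i\<in>A. s i = t i) \<longrightarrow> f s = f t)"

lemma depends_onD: "depends_on A f \<Longrightarrow> (\<And>i. i \<in> A \<Longrightarrow> s i = t i) \<Longrightarrow> f s = f t"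
  by (auto simp: depends_on_def)

lemma depends_on_const [simp]: "depends_on A (\<lambda>_. c)"
  by (simp add: depends_on_def)

lemma depends_on_empty: "depends_on {} f \<Longrightarrow> f s = f t"
  by (simp add: depends_on_def)

lemma depends_on_mono: "depends_on A f \<Longrightarrow> A \<subseteq> B \<Longrightarrow> depends_on B f"
  unfolding depends_on_def by blast

lemma depends_on_comp:
  assumes "depends_on A f"
  shows "depends_on A (\<lambda>s. h (f s))"
  using assms unfolding depends_on_def by metis

lemma depends_on_comp2:
  assumes "depends_on A f" "depends_on A g"
  shows "depends_on A (\<lambda>s. h (f s) (g s))"
  using assms unfolding depends_on_def by metis

text \<open>The point that copies \<open>s\<close> on \<open>A\<close> and \<open>t\<close>
  elsewhere agrees with \<open>t\<close> on all of \<open>B\<close>, so \<open>f\<close> keeps its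
  value on the way from \<open>s\<close> through it to \<open>t\<close>.\<close>

lemma depends_on_Int:
  assumes "depends_on A f" "depends_on B f"
  shows "depends_on (A \<inter> B) f"
  unfolding depends_on_def
proof (intro allI impI)
  fix s t :: "'a \<Rightarrow> 'b" assume eq: "\<forall>i\<in>A \<inter> B. s i = t i"
  let ?u = "\<lambda>i. if i \<in> A then s i else t i"
  have "f s = f ?u" by (rule depends_onD[OF assms(1)]) simp
  also have "\<dots> = f t" by (rule depends_onD[OF assms(2)]) (use eq in auto)
  finally show "f s = f t" .
qed

lemma depends_on_upd:
  assumes "depends_on A f"
  shows "depends_on (A - {i}) (\<lambda>s. f (s(i := k)))"
  using assms unfolding depends_on_def by (metis Diff_iff fun_upd_apply singletonD)

lemma depends_on_upd_notin:
  assumes "depends_on A f" "i \<notin> A"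
  shows "f (s(i := k)) = f s"
  by (rule depends_onD[OF assms(1)]) (use assms(2) in auto)

text \<open>Largeness in the iterated (Fubini) product of copies of \<open>U\<close>, the head of
  the list being the outermost quantifier. The base point zero is immaterial for predicates that
  depend only on listed coordinates, as all of these are overwritten.\<close>

primrec iter_eventually :: "'n::zero filter \<Rightarrow> 'i list \<Rightarrow> (('i \<Rightarrow> 'n) \<Rightarrow> bool) \<Rightarrow> bool" where
  "iter_eventually U [] P \<longleftrightarrow> P (\<lambda>_. 0)"
| "iter_eventually U (i # xs) P \<longleftrightarrow> (\<forall>\<^sub>F k in U. iter_eventually U xs (\<lambda>s. P (s(i := k))))"

lemma iter_eventually_not:
  "free_ultrafilter U \<Longrightarrow> iter_eventually U xs (\<lambda>s. \<not> P s) \<longleftrightarrow> \<not> iter_eventually U xs P"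
  by (induction xs arbitrary: P) (simp_all add: free_ultrafilter_not)

lemma iter_eventually_conj:
  "iter_eventually U xs (\<lambda>s. P s \<and> Q s) \<longleftrightarrow> iter_eventually U xs P \<and> iter_eventually U xs Q"
  by (induction xs arbitrary: P Q) (simp_all add: eventually_conj_iff)

lemma iter_eventually_mono:
  assumes "iter_eventually U xs P" "\<And>s. P s \<Longrightarrow> Q s"
  shows "iter_eventually U xs Q"
proof -
  have "P = (\<lambda>s. P s \<and> Q s)" using assms(2) by blast
  then show ?thesis using assms(1) iter_eventually_conj by metis
qed

text \<open>Quantifying over a coordinate outside the support is quantifying a constant over a
  proper filter. This allows tests along different lists to be compared.\<close>

lemma iter_eventually_filter:
  assumes "free_ultrafilter U" "depends_on A P"
  shows "iter_eventually U (filter (\<lambda>i. i \<in> A) xs) P \<longleftrightarrow> iter_eventually U xs P"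
  using assms(2)
proof (induction xs arbitrary: P)
  case (Cons i xs)
  show ?case
  proof (cases "i \<in> A")
    case True
    have "iter_eventually U (filter (\<lambda>i. i \<in> A) xs) (\<lambda>s. P (s(i := k)))
        \<longleftrightarrow> iter_eventually U xs (\<lambda>s. P (s(i := k)))" for k
      by (rule Cons.IH, rule depends_on_mono[OF depends_on_upd[OF Cons.prems]]) auto
    then show ?thesis using True by simp
  next
    case False
    note Pu = depends_on_upd_notin[OF Cons.prems this]
    show ?thesis using Cons False by (simp add: Pu free_ultrafilter_const[OF assms(1)])
  qed
qed simp

text \<open>Coordinates outside \<open>A \<inter> B\<close> are frozen at a typical value, one after the other.\<close>

lemma iter_eventually_eq_common_support:
  assumes U: "free_ultrafilter U" and "distinct xs" and "A \<union> B \<subseteq> set xs"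
    and "depends_on A f" "depends_on B g" "iter_eventually U xs (\<lambda>s. f s = g s)"
  shows "\<exists>h. depends_on (A \<inter> B) h \<and> iter_eventually U xs (\<lambda>s. h s = f s)"
  using assms(2-)
proof (induction xs arbitrary: A B f g)
  case Nil
  then show ?case by auto
next
  case (Cons i xs)
  let ?f = "\<lambda>k s. f (s(i := k))" and ?g = "\<lambda>k s. g (s(i := k))"
  let ?good = "\<lambda>k. iter_eventually U xs (\<lambda>s. ?f k s = ?g k s)"
  have good: "eventually ?good U" using Cons.prems(5) by simp
  have IH: "\<exists>h. depends_on (A \<inter> B - {i}) h \<and> iter_eventually U xs (\<lambda>s. h s = ?f k s)"
    if "?good k" for k
  proof -
    have "\<exists>h. depends_on ((A - {i}) \<inter> (B - {i})) h \<and> iter_eventually U xs (\<lambda>s. h s = ?f k s)"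
    proof (rule Cons.IH[where f = "?f k" and g = "?g k"])
      show "depends_on (A - {i}) (?f k)" "depends_on (B - {i}) (?g k)"
        using Cons.prems by (auto intro: depends_on_upd)
    qed (use Cons.prems that in auto)
    moreover have "(A - {i}) \<inter> (B - {i}) = A \<inter> B - {i}" by auto
    ultimately show ?thesis by simp
  qed
  show ?case
  proof (cases "i \<in> A \<inter> B")
    case True
    \<comment> \<open>A common coordinate is kept: a function is chosen for each of its values
      \<open>k\<close>, an arbitrary constant where \<open>k\<close> is not good.\<close>
    have "\<exists>h. depends_on (A \<inter> B - {i}) h \<and> (?good k \<longrightarrow> iter_eventually U xs (\<lambda>s. h s = ?f k s))" for k
    proof (cases "?good k")
      case True
      then show ?thesis using IH[of k] by simp
    next
      case False
      then show ?thesis by (intro exI[of _ "\<lambda>_. undefined"]) simp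
    qed
    then have "\<exists>h. \<forall>k. depends_on (A \<inter> B - {i}) (h k) \<and>
        (?good k \<longrightarrow> iter_eventually U xs (\<lambda>s. h k s = ?f k s))"
      by (intro choice allI)
    then obtain h where h: "\<And>k. depends_on (A \<inter> B - {i}) (h k)"
      "\<And>k. ?good k \<Longrightarrow> iter_eventually U xs (\<lambda>s. h k s = ?f k s)" by auto
    \<comment> \<open>The chosen functions are glued by reading the index off coordinate
      \<open>i\<close>. Each \<open>h k\<close> ignores \<open>i\<close>, so setting
      \<open>i\<close> to \<open>k\<close> in \<open>?h\<close> leaves just
      \<open>h k\<close>.\<close>
    let ?h = "\<lambda>s. h (s i) s"
    have "depends_on (A \<inter> B) ?h"
      unfolding depends_on_def
    proof (intro allI impI)
      fix s t :: "'b \<Rightarrow> 'a" assume eq: "\<forall>j\<in>A \<inter> B. s j = t j"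
      then have "s i = t i" using True by blast
      moreover have "h (t i) s = h (t i) t" by (rule depends_onD[OF h(1)]) (use eq in auto)
      ultimately show "h (s i) s = h (t i) t" by simp
    qed
    moreover have "h k (s(i := k)) = h k s" for k s
      by (rule depends_on_upd_notin[OF h(1)]) simp
    then have "iter_eventually U (i # xs) (\<lambda>s. ?h s = f s)"
      using good h(2) by (auto elim: eventually_mono)
    ultimately show ?thesis by blast
  next
    case False
    \<comment> \<open>A coordinate that is not common is frozen at one good value; the resulting
      \<open>h\<close> does not mention it.\<close>
    obtain k where k: "?good k" using eventually_happens[OF good] U unfolding free_ultrafilter_def by blast
    from IH[OF k] obtain h where h: "depends_on (A \<inter> B) h"
      and hf: "iter_eventually U xs (\<lambda>s. h s = ?f k s)"
      using False by (metis Diff_empty Diff_insert0)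
    have hg: "iter_eventually U xs (\<lambda>s. h s = ?g k s)"
    proof (rule iter_eventually_mono)
      show "iter_eventually U xs (\<lambda>s. h s = ?f k s \<and> ?f k s = ?g k s)"
        using hf k by (simp add: iter_eventually_conj)
    qed simp
    have hu: "h (s(i := l)) = h s" for s l
      by (rule depends_on_upd_notin[OF h]) (use False in simp)
    \<comment> \<open>At least one of \<open>f\<close> and \<open>g\<close> ignores \<open>i\<close>
      and is unaffected by the freezing, so \<open>h\<close> agrees with it. If only
      \<open>g\<close> does, the assumed agreement of \<open>f\<close> and \<open>g\<close> leads
      back to \<open>f\<close>.\<close>
    have "iter_eventually U (i # xs) (\<lambda>s. h s = f s)"
    proof (cases "i \<in> A")
      case True
      then have "i \<notin> B" using False by simp
      note gu = depends_on_upd_notin[OF Cons.prems(4) this]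
      have "iter_eventually U (i # xs) (\<lambda>s. h s = g s)"
        using hg by (simp add: hu gu free_ultrafilter_const[OF U])
      then have "iter_eventually U (i # xs) (\<lambda>s. h s = g s \<and> f s = g s)"
        using Cons.prems(5) unfolding iter_eventually_conj by simp
      then show ?thesis by (rule iter_eventually_mono) simp
    next
      case False
      note fu = depends_on_upd_notin[OF Cons.prems(3) this]
      show ?thesis using hf by (simp add: hu fu free_ultrafilter_const[OF U])
    qed
    with h show ?thesis by blast
  qed
qed


section \<open>Sorted enumerations of finite sets\<close>

text \<open>Were the heads different, each would occur in the tail of the other list and so lie both
  below and above the other. This makes quantification in the order of \<open>less\<close>
  canonical.\<close>

lemma sorted_wrt_set_unique:
  assumes "irrefl r" "trans r"
    and "sorted_wrt (\<lambda>i j. (i, j) \<in> r) xs" "sorted_wrt (\<lambda>i j. (i, j) \<in> r) ys" "set xs = set ys"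
  shows "xs = ys"
  using assms(3-)
proof (induction xs arbitrary: ys)
  case (Cons x xs)
  then obtain y ys' where ys: "ys = y # ys'" by (cases ys) auto
  have asym: "(j, i) \<notin> r" if "(i, j) \<in> r" for i j
    using that assms(1,2) by (meson irreflD transD)
  have irr: "(i, i) \<notin> r" for i using assms(1) by (meson irreflD)
  have "x = y"
  proof (rule ccontr)
    assume "x \<noteq> y"
    then have "x \<in> set ys'" "y \<in> set xs" using Cons.prems(3) unfolding ys by auto
    then show False using Cons.prems(1,2) asym unfolding ys by auto
  qed
  moreover have "x \<notin> set xs" "y \<notin> set ys'" using Cons.prems(1,2) irr unfolding ys by auto
  then have "set xs = set ys'" using Cons.prems(3) \<open>x = y\<close> unfolding ys by auto
  ultimately show ?case using Cons ys by auto
qed simp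

lemma sorted_wrt_irrefl_distinct:
  assumes "irrefl r" "sorted_wrt (\<lambda>i j. (i, j) \<in> r) xs"
  shows "distinct xs"
  using assms(2) by (induction xs) (use assms(1) in \<open>auto dest: irreflD\<close>)

lemma sorted_wrt_exists:
  assumes "strict_linear_order_on I r" "finite F" "F \<subseteq> I"
  shows "\<exists>xs. sorted_wrt (\<lambda>i j. (i, j) \<in> r) xs \<and> set xs = F"
  using assms(2,3)
proof (induction F)
  case (insert x F)
  then obtain xs where xs: "sorted_wrt (\<lambda>i j. (i, j) \<in> r) xs" "set xs = F" by auto
  have tr: "trans r" and tot: "total_on I r"
    using assms(1) by (auto simp: strict_linear_order_on_def)
  let ?ys = "filter (\<lambda>y. (y, x) \<in> r) xs @ x # filter (\<lambda>y. (x, y) \<in> r) xs"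
  have "sorted_wrt (\<lambda>i j. (i, j) \<in> r) ?ys"
    using xs(1) tr by (auto simp: sorted_wrt_append sorted_wrt_filter dest: transD)
  moreover have "set ?ys = insert x F"
    using xs(2) insert.hyps insert.prems tot unfolding total_on_def by auto
  ultimately show ?case by blast
qed simp


section \<open>Variables of a formula\<close>

fun trm_vars :: "'f trm \<Rightarrow> nat set" where
  "trm_vars (Var n) = {n}"
| "trm_vars (Fn f ts) = (\<Union>t\<in>set ts. trm_vars t)"

text \<open>Bound variables are counted as well; the set serves as a finite bound on the values of
  an assignment that can influence the truth of a formula.\<close>

fun fm_vars :: "('f, 'r) fm \<Rightarrow> nat set" where
  "fm_vars (Eq s t) = trm_vars s \<union> trm_vars t"
| "fm_vars (Rel r ts) = (\<Union>t\<in>set ts. trm_vars t)"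
| "fm_vars (Neg p) = fm_vars p"
| "fm_vars (Conj p q) = fm_vars p \<union> fm_vars q"
| "fm_vars (Ex n p) = fm_vars p"

lemma finite_trm_vars: "finite (trm_vars t)"
  by (induction t) auto

lemma finite_fm_vars: "finite (fm_vars p)"
  by (induction p) (auto simp: finite_trm_vars)

lemma eval_cong_vars: "(\<And>n. n \<in> trm_vars t \<Longrightarrow> d n = e n) \<Longrightarrow> eval M d t = eval M e t"
proof (induction t)
  case (Fn f ts)
  then have "map (eval M d) ts = map (eval M e) ts" by auto
  then show ?case by (metis eval.simps(2))
qed simp

lemma sat_cong_vars: "(\<And>n. n \<in> fm_vars p \<Longrightarrow> d n = e n) \<Longrightarrow> sat M d p = sat M e p"
proof (induction p arbitrary: d e)
  case (Eq s t)
  then show ?case using eval_cong_vars[of s d e M] eval_cong_vars[of t d e M] by simp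
next
  case (Rel r ts)
  have "map (eval M d) ts = map (eval M e) ts"
    using Rel by (auto intro!: eval_cong_vars)
  then show ?case by (metis sat.simps(2))
next
  case (Neg p)
  have "sat M d p = sat M e p" by (rule Neg.IH) (use Neg.prems in auto)
  then show ?case by simp
next
  case (Conj p q)
  have "sat M d p = sat M e p" by (rule Conj.IH(1)) (use Conj.prems in auto)
  moreover have "sat M d q = sat M e q" by (rule Conj.IH(2)) (use Conj.prems in auto)
  ultimately show ?case by simp
next
  case (Ex n p)
  have "sat M (d(n := a)) p = sat M (e(n := a)) p" for a
    by (rule Ex.IH) (use Ex.prems in auto)
  then show ?case by simp
qed


section \<open>The iterated ultrapower\<close>

locale iterated_ultrapower =
  fixes L :: "('f, 'r) language"
    and M :: "('f, 'r, 'm) fo_struct"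
    and I :: "'i set"
    and less :: "'i rel"
    and U :: "nat filter"
  assumes M: "is_struct L M"
    and less: "strict_linear_order_on I less"
    and U: "free_ultrafilter U"
begin

abbreviation sorted_less :: "'i list \<Rightarrow> bool" where
  "sorted_less \<equiv> sorted_wrt (\<lambda>i j. (i, j) \<in> less)"

lemma irrefl_less: "irrefl less" and trans_less: "trans less"
  using less by (auto simp: strict_linear_order_on_def)

section \<open>Finite supports and truth almost everywhere\<close>

definition fin_supp :: "(('i \<Rightarrow> nat) \<Rightarrow> 'b) \<Rightarrow> bool" where
  "fin_supp f \<longleftrightarrow> (\<exists>F. finite F \<and> F \<subseteq> I \<and> depends_on F f)"

text \<open>Having a finite support in \<open>I\<close> is built in. The list is sorted because
  quantifiers over different coordinates do not commute; by \<open>almost_iff\<close> the choice of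
  the support is immaterial.\<close>

definition almost :: "(('i \<Rightarrow> nat) \<Rightarrow> bool) \<Rightarrow> bool" where
  "almost P \<longleftrightarrow> (\<exists>xs. sorted_less xs \<and> set xs \<subseteq> I \<and> depends_on (set xs) P \<and> iter_eventually U xs P)"

lemma fin_suppI: "finite F \<Longrightarrow> F \<subseteq> I \<Longrightarrow> depends_on F f \<Longrightarrow> fin_supp f"
  by (auto simp: fin_supp_def)

lemma fin_supp_const [simp]: "fin_supp (\<lambda>_. c)"
  by (rule fin_suppI[of "{}"]) auto

lemma fin_supp_comp: "fin_supp f \<Longrightarrow> fin_supp (\<lambda>s. h (f s))"
  unfolding fin_supp_def using depends_on_comp[of _ f h] by blast

lemma fin_supp_comp2:
  assumes "fin_supp f" "fin_supp g"
  shows "fin_supp (\<lambda>s. h (f s) (g s))"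
proof -
  obtain F G where F: "finite F" "F \<subseteq> I" "depends_on F f" and G: "finite G" "G \<subseteq> I" "depends_on G g"
    using assms by (auto simp: fin_supp_def)
  have "depends_on (F \<union> G) (\<lambda>s. h (f s) (g s))"
    by (rule depends_on_comp2[OF depends_on_mono[OF F(3)] depends_on_mono[OF G(3)]]) auto
  with F G show ?thesis by (auto intro: fin_suppI[of "F \<union> G"])
qed

lemma fin_supp_finite:
  assumes "finite A" "\<And>a. a \<in> A \<Longrightarrow> fin_supp (f a)"
  shows "\<exists>F. finite F \<and> F \<subseteq> I \<and> (\<forall>a\<in>A. depends_on F (f a))"
  using assms
proof (induction A)
  case (insert a A)
  then obtain F where F: "finite F" "F \<subseteq> I" "\<forall>a\<in>A. depends_on F (f a)" by auto
  obtain G where G: "finite G" "G \<subseteq> I" "depends_on G (f a)"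
    using insert.prems by (auto simp: fin_supp_def)
  have "\<forall>b\<in>insert a A. depends_on (F \<union> G) (f b)"
    using F(3) G(3) depends_on_mono[of _ _ "F \<union> G"] by blast
  with F G show ?case by (intro exI[of _ "F \<union> G"]) auto
qed auto

lemma fin_supp_map:
  assumes "\<And>x. x \<in> set xs \<Longrightarrow> fin_supp (f x)"
  shows "fin_supp (\<lambda>s. map (\<lambda>x. f x s) xs)"
  using assms
proof (induction xs)
  case (Cons x xs)
  then show ?case using fin_supp_comp2[of "f x" "\<lambda>s. map (\<lambda>x. f x s) xs" Cons] by simp
qed simp

lemma fin_supp_sorted:
  assumes "fin_supp f" "fin_supp g"
  obtains xs where "sorted_less xs" "set xs \<subseteq> I" "depends_on (set xs) f" "depends_on (set xs) g"
proof -
  obtain F G where F: "finite F" "F \<subseteq> I" "depends_on F f" and G: "finite G" "G \<subseteq> I" "depends_on G g"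
    using assms by (auto simp: fin_supp_def)
  obtain xs where "sorted_less xs" "set xs = F \<union> G"
    using sorted_wrt_exists[OF less, of "F \<union> G"] F G by auto
  with F G show thesis by (auto intro!: that[of xs] intro: depends_on_mono)
qed

text \<open>Two sorted lists that support \<open>P\<close>, filtered down to their common elements,
  become the same list, and the dropped coordinates lie outside a support.\<close>

lemma almost_iff:
  assumes xs: "sorted_less xs" "set xs \<subseteq> I" and P: "depends_on (set xs) P"
  shows "almost P \<longleftrightarrow> iter_eventually U xs P"
proof
  assume "almost P"
  then obtain ys where ys: "sorted_less ys" "set ys \<subseteq> I" "depends_on (set ys) P"
    "iter_eventually U ys P" by (auto simp: almost_def)
  let ?A = "set xs \<inter> set ys"
  have A: "depends_on ?A P" using P ys(3) by (rule depends_on_Int)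
  have "filter (\<lambda>i. i \<in> ?A) xs = filter (\<lambda>i. i \<in> ?A) ys"
    by (rule sorted_wrt_set_unique[OF irrefl_less trans_less])
      (use xs ys in \<open>auto intro: sorted_wrt_filter\<close>)
  then show "iter_eventually U xs P"
    using ys(4) iter_eventually_filter[OF U A] by metis
qed (use assms in \<open>auto simp: almost_def\<close>)

lemma almost_const [simp]: "almost (\<lambda>_. c) \<longleftrightarrow> c"
  by (simp add: almost_iff[of "[]"])

lemma almost_not:
  assumes "fin_supp P"
  shows "almost (\<lambda>s. \<not> P s) \<longleftrightarrow> \<not> almost P"
proof -
  obtain xs where "sorted_less xs" "set xs \<subseteq> I" "depends_on (set xs) P"
    using fin_supp_sorted[OF assms assms] .
  then show ?thesis
    using depends_on_comp[of _ P Not] by (simp add: almost_iff iter_eventually_not[OF U])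
qed

lemma almost_conj:
  assumes "fin_supp P" "fin_supp Q"
  shows "almost (\<lambda>s. P s \<and> Q s) \<longleftrightarrow> almost P \<and> almost Q"
proof -
  obtain xs where "sorted_less xs" "set xs \<subseteq> I" "depends_on (set xs) P" "depends_on (set xs) Q"
    using fin_supp_sorted[OF assms] .
  then show ?thesis
    using depends_on_comp2[of _ P Q "(\<and>)"] by (simp add: almost_iff iter_eventually_conj)
qed

lemma almost_mono:
  assumes "almost P" "fin_supp P" "fin_supp Q" "\<And>s. P s \<Longrightarrow> Q s"
  shows "almost Q"
proof -
  have "P = (\<lambda>s. P s \<and> Q s)" using assms(4) by blast
  then show ?thesis using assms(1) almost_conj[OF assms(2,3)] by metis
qed

lemma almost_mono2:
  assumes "almost P" "almost Q" "fin_supp P" "fin_supp Q" "fin_supp R" "\<And>s. P s \<Longrightarrow> Q s \<Longrightarrow> R s"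
  shows "almost R"
proof (rule almost_mono)
  show "almost (\<lambda>s. P s \<and> Q s)" using assms almost_conj by blast
  show "fin_supp (\<lambda>s. P s \<and> Q s)" using assms(3,4) by (rule fin_supp_comp2)
qed (use assms in auto)

lemma almost_ex:
  assumes "almost P"
  shows "\<exists>s. P s"
proof (rule ccontr)
  assume "\<nexists>s. P s"
  then have "P = (\<lambda>_. False)" by blast
  with assms show False by simp
qed

lemma fin_supp_eq: "fin_supp f \<Longrightarrow> fin_supp g \<Longrightarrow> fin_supp (\<lambda>s. f s = g s)"
  by (rule fin_supp_comp2)

lemma almost_eq_trans:
  assumes "almost (\<lambda>s. f s = g s)" "almost (\<lambda>s. g s = h s)" "fin_supp f" "fin_supp g" "fin_supp h"
  shows "almost (\<lambda>s. f s = h s)"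
  by (rule almost_mono2[OF assms(1,2)]) (use assms in \<open>auto intro: fin_supp_eq\<close>)

lemma almost_eq_sym: "almost (\<lambda>s. f s = g s) \<longleftrightarrow> almost (\<lambda>s. g s = f s)"
  by (rule arg_cong[of _ _ almost]) auto

lemma almost_map_eq:
  assumes "\<And>x. x \<in> set xs \<Longrightarrow> fin_supp (f x)" "\<And>x. x \<in> set xs \<Longrightarrow> fin_supp (g x)"
    "\<And>x. x \<in> set xs \<Longrightarrow> almost (\<lambda>s. f x s = g x s)"
  shows "almost (\<lambda>s. map (\<lambda>x. f x s) xs = map (\<lambda>x. g x s) xs)"
  using assms
proof (induction xs)
  case (Cons x xs)
  have "almost (\<lambda>s. f x s = g x s \<and> map (\<lambda>x. f x s) xs = map (\<lambda>x. g x s) xs)"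
  proof (subst almost_conj)
    show "fin_supp (\<lambda>s. f x s = g x s)" using Cons.prems by (auto intro: fin_supp_eq)
    show "fin_supp (\<lambda>s. map (\<lambda>x. f x s) xs = map (\<lambda>x. g x s) xs)"
      using Cons.prems by (intro fin_supp_eq fin_supp_map) auto
    show "almost (\<lambda>s. f x s = g x s) \<and> almost (\<lambda>s. map (\<lambda>x. f x s) xs = map (\<lambda>x. g x s) xs)"
      using Cons by auto
  qed
  then show ?case by simp
qed simp

section \<open>Classes modulo almost everywhere equality and the structure on them\<close>

definition elems :: "(('i \<Rightarrow> nat) \<Rightarrow> 'm) set" where
  "elems = {f. fin_supp f \<and> range f \<subseteq> universe M}"

text \<open>
  \<open>cls\<close> picks a name in the ambient type for the class of a function modulo almost everywhere
  equality, in such a way that the class of a constant is named by its value.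
\<close>

definition cls :: "(('i \<Rightarrow> nat) \<Rightarrow> 'm) \<Rightarrow> ('i, 'm) ambient" where
  "cls f = (if \<exists>m\<in>universe M. almost (\<lambda>s. f s = m)
     then Inl (SOME m. m \<in> universe M \<and> almost (\<lambda>s. f s = m))
     else Inr (SOME g. g \<in> elems \<and> almost (\<lambda>s. f s = g s)))"

definition rep :: "('i, 'm) ambient \<Rightarrow> ('i \<Rightarrow> nat) \<Rightarrow> 'm" where
  "rep x = (case x of Inl m \<Rightarrow> (\<lambda>_. m) | Inr g \<Rightarrow> g)"

text \<open>The interpretations are pointwise on representatives; \<open>fun_int_power\<close> and
  \<open>rel_int_power\<close> show that other members of the classes give the same result.\<close>

definition power :: "('f, 'r, ('i, 'm) ambient) fo_struct" where
  "power = \<lparr>universe = cls ` elems,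
     fun_int = \<lambda>f xs. cls (\<lambda>s. fun_int M f (map (\<lambda>x. rep x s) xs)),
     rel_int = \<lambda>r xs. almost (\<lambda>s. rel_int M r (map (\<lambda>x. rep x s) xs))\<rparr>"

lemma power_simps [simp]:
  "universe power = cls ` elems"
  "fun_int power f xs = cls (\<lambda>s. fun_int M f (map (\<lambda>x. rep x s) xs))"
  "rel_int power r xs = almost (\<lambda>s. rel_int M r (map (\<lambda>x. rep x s) xs))"
  by (simp_all add: power_def)

lemma elems_const [simp]: "(\<lambda>_. m) \<in> elems \<longleftrightarrow> m \<in> universe M"
  by (auto simp: elems_def)

lemma elems_fin_supp: "f \<in> elems \<Longrightarrow> fin_supp f"
  by (simp add: elems_def)

lemma elems_universe: "f \<in> elems \<Longrightarrow> f s \<in> universe M"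
  by (auto simp: elems_def)

lemma rep_cls:
  assumes f: "f \<in> elems"
  shows "rep (cls f) \<in> elems" "almost (\<lambda>s. f s = rep (cls f) s)"
proof -
  have "rep (cls f) \<in> elems \<and> almost (\<lambda>s. f s = rep (cls f) s)"
  proof (cases "\<exists>m\<in>universe M. almost (\<lambda>s. f s = m)")
    case True
    then have "\<exists>m. m \<in> universe M \<and> almost (\<lambda>s. f s = m)" by blast
    from someI_ex[OF this] True show ?thesis by (simp add: cls_def rep_def)
  next
    case False
    have "\<exists>g. g \<in> elems \<and> almost (\<lambda>s. f s = g s)" using f by (intro exI[of _ f]) simp
    from someI_ex[OF this] False show ?thesis by (simp add: cls_def rep_def)
  qed
  then show "rep (cls f) \<in> elems" "almost (\<lambda>s. f s = rep (cls f) s)" by auto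
qed

text \<open>The case distinction and both choices in \<open>cls\<close> see a function only through
  the functions almost equal to it, and these are the same for \<open>f\<close> and
  \<open>g\<close>.\<close>

lemma cls_eqI:
  assumes "f \<in> elems" "g \<in> elems" "almost (\<lambda>s. f s = g s)"
  shows "cls f = cls g"
proof -
  have *: "almost (\<lambda>s. f s = h s) \<longleftrightarrow> almost (\<lambda>s. g s = h s)" if "fin_supp h" for h
    using assms that almost_eq_trans[of f g h] almost_eq_trans[of g f h]
    by (auto simp: elems_def almost_eq_sym[of g f])
  have "(m \<in> universe M \<and> almost (\<lambda>s. f s = m)) \<longleftrightarrow> (m \<in> universe M \<and> almost (\<lambda>s. g s = m))" for m
    using *[of "\<lambda>_. m"] by simp
  moreover have "(h \<in> elems \<and> almost (\<lambda>s. f s = h s)) \<longleftrightarrow> (h \<in> elems \<and> almost (\<lambda>s. g s = h s))" for h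
    using *[of h] by (auto simp: elems_def)
  ultimately show ?thesis by (simp add: cls_def Bex_def)
qed

lemma cls_eq_iff:
  assumes "f \<in> elems" "g \<in> elems"
  shows "cls f = cls g \<longleftrightarrow> almost (\<lambda>s. f s = g s)"
proof
  assume "cls f = cls g"
  then have "almost (\<lambda>s. f s = rep (cls f) s)" "almost (\<lambda>s. rep (cls f) s = g s)"
    "rep (cls f) \<in> elems"
    using rep_cls[OF assms(1)] rep_cls[OF assms(2)] by (auto simp: almost_eq_sym[of _ g])
  then show "almost (\<lambda>s. f s = g s)"
    using assms by (auto intro: almost_eq_trans dest: elems_fin_supp)
qed (rule cls_eqI[OF assms])

lemma cls_const:
  assumes "m \<in> universe M"
  shows "cls (\<lambda>_. m) = Inl m"
proof -
  have "(SOME k. k \<in> universe M \<and> m = k) = m" using assms by (intro some_equality) auto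
  then show ?thesis using assms by (simp add: cls_def)
qed

lemma rep_Inl [simp]: "rep (Inl m) = (\<lambda>_. m)"
  by (simp add: rep_def)

lemma rep_elems: "x \<in> cls ` elems \<Longrightarrow> rep x \<in> elems"
  by (auto simp: rep_cls(1))

lemma fun_elems:
  assumes "f \<in> fun_syms L" "length xs = fun_arity L f" "\<And>x. x \<in> set xs \<Longrightarrow> g x \<in> elems"
  shows "(\<lambda>s. fun_int M f (map (\<lambda>x. g x s) xs)) \<in> elems"
proof -
  have "map (\<lambda>x. g x s) xs \<in> tuples (universe M) (fun_arity L f)" for s
    using assms by (auto simp: tuples_def elems_universe)
  then have "fun_int M f (map (\<lambda>x. g x s) xs) \<in> universe M" for s
    using M assms(1) by (auto simp: is_struct_def)
  moreover have "fin_supp (\<lambda>s. fun_int M f (map (\<lambda>x. g x s) xs))"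
    using assms(3) by (intro fin_supp_comp[where h = "fun_int M f"] fin_supp_map elems_fin_supp)
  ultimately show ?thesis by (auto simp: elems_def)
qed

lemma almost_map_rep_cls:
  assumes "\<And>x. x \<in> set xs \<Longrightarrow> g x \<in> elems"
  shows "almost (\<lambda>s. map (\<lambda>x. g x s) xs = map (\<lambda>x. rep (cls (g x)) s) xs)"
  by (rule almost_map_eq) (simp_all add: assms elems_fin_supp rep_cls)

lemma fun_int_power:
  assumes f: "f \<in> fun_syms L" and len: "length xs = fun_arity L f"
    and g: "\<And>x. x \<in> set xs \<Longrightarrow> g x \<in> elems"
  shows "fun_int power f (map (\<lambda>x. cls (g x)) xs) = cls (\<lambda>s. fun_int M f (map (\<lambda>x. g x s) xs))"
proof -
  have "cls (\<lambda>s. fun_int M f (map (\<lambda>x. rep (cls (g x)) s) xs)) = cls (\<lambda>s. fun_int M f (map (\<lambda>x. g x s) xs))"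
  proof (rule cls_eqI)
    show e: "(\<lambda>s. fun_int M f (map (\<lambda>x. rep (cls (g x)) s) xs)) \<in> elems"
      "(\<lambda>s. fun_int M f (map (\<lambda>x. g x s) xs)) \<in> elems"
      by (rule fun_elems[OF f len rep_cls(1)[OF g]], assumption) (rule fun_elems[OF f len g], assumption)
    show "almost (\<lambda>s. fun_int M f (map (\<lambda>x. rep (cls (g x)) s) xs) = fun_int M f (map (\<lambda>x. g x s) xs))"
    proof (rule almost_mono[OF almost_map_rep_cls[OF g]])
      show "fin_supp (\<lambda>s. map (\<lambda>x. g x s) xs = map (\<lambda>x. rep (cls (g x)) s) xs)"
        using g by (intro fin_supp_eq fin_supp_map elems_fin_supp rep_cls)
      show "fin_supp (\<lambda>s. fun_int M f (map (\<lambda>x. rep (cls (g x)) s) xs) = fun_int M f (map (\<lambda>x. g x s) xs))"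
        using e by (intro fin_supp_eq elems_fin_supp)
    qed (simp_all del: map_eq_conv)
  qed
  then show ?thesis by (simp add: comp_def)
qed

lemma rel_int_power:
  assumes g: "\<And>x. x \<in> set xs \<Longrightarrow> g x \<in> elems"
  shows "rel_int power r (map (\<lambda>x. cls (g x)) xs) \<longleftrightarrow> almost (\<lambda>s. rel_int M r (map (\<lambda>x. g x s) xs))"
proof -
  have f: "fin_supp (\<lambda>s. map (\<lambda>x. g x s) xs)" "fin_supp (\<lambda>s. map (\<lambda>x. rep (cls (g x)) s) xs)"
    using g by (auto intro!: fin_supp_map elems_fin_supp rep_cls)
  have "almost (\<lambda>s. rel_int M r (map (\<lambda>x. rep (cls (g x)) s) xs)) \<longleftrightarrow>
      almost (\<lambda>s. rel_int M r (map (\<lambda>x. g x s) xs))" (is "almost ?P \<longleftrightarrow> almost ?Q")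
  proof -
    have P: "fin_supp ?P" and Q: "fin_supp ?Q" using f by (auto intro!: fin_supp_comp[where h = "rel_int M r"])
    note E = almost_map_rep_cls[of xs g, OF g] fin_supp_eq[OF f]
    show ?thesis
    proof
      assume "almost ?P"
      from almost_mono2[OF this E(1) P E(2) Q] show "almost ?Q" by (simp del: map_eq_conv)
    next
      assume "almost ?Q"
      from almost_mono2[OF this E(1) Q E(2) P] show "almost ?P" by (simp del: map_eq_conv)
    qed
  qed
  then show ?thesis by (simp add: comp_def)
qed

lemma is_struct_power: "is_struct L power"
proof -
  obtain m where "m \<in> universe M" using M by (auto simp: is_struct_def)
  then have "elems \<noteq> {}" using elems_const by blast
  moreover have "fun_int power f xs \<in> universe power"
    if "f \<in> fun_syms L" "xs \<in> tuples (universe power) (fun_arity L f)" for f xs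
    using that by (auto simp: tuples_def subset_iff intro!: imageI fun_elems rep_elems)
  ultimately show ?thesis unfolding is_struct_def by auto
qed

section \<open>Los's theorem\<close>

lemma eval_power:
  assumes "is_trm L t" and d: "\<And>k. d k \<in> elems"
  shows "(\<lambda>s. eval M (\<lambda>k. d k s) t) \<in> elems \<and>
    eval power (\<lambda>k. cls (d k)) t = cls (\<lambda>s. eval M (\<lambda>k. d k s) t)"
  using assms(1)
proof (induction t)
  case (Var n)
  then show ?case using d[of n] by simp
next
  case (Fn f ts)
  let ?g = "\<lambda>t s. eval M (\<lambda>k. d k s) t"
  have g: "?g t \<in> elems" "eval power (\<lambda>k. cls (d k)) t = cls (?g t)" if "t \<in> set ts" for t
    using Fn that by auto
  have m: "map (eval power (\<lambda>k. cls (d k))) ts = map (\<lambda>t. cls (?g t)) ts" using g by simp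
  have f: "f \<in> fun_syms L" "length ts = fun_arity L f" using Fn.prems by auto
  have "eval power (\<lambda>k. cls (d k)) (Fn f ts) = cls (\<lambda>s. fun_int M f (map (\<lambda>t. ?g t s) ts))"
    unfolding eval.simps m by (rule fun_int_power[OF f g(1)])
  moreover have "(\<lambda>s. fun_int M f (map (\<lambda>t. ?g t s) ts)) \<in> elems"
    using f g(1) by (rule fun_elems)
  ultimately show ?case by simp
qed

lemma depends_on_sat:
  fixes d :: "nat \<Rightarrow> ('i \<Rightarrow> nat) \<Rightarrow> 'm"
  assumes "\<forall>k\<in>fm_vars p. depends_on F (d k)"
  shows "depends_on F (\<lambda>s. sat M (\<lambda>k. d k s) p)"
  unfolding depends_on_def
proof (intro allI impI)
  fix s t :: "'i \<Rightarrow> nat" assume "\<forall>i\<in>F. s i = t i"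
  then show "sat M (\<lambda>k. d k s) p = sat M (\<lambda>k. d k t) p"
    using assms by (intro sat_cong_vars) (auto intro: depends_onD)
qed

text \<open>The functions \<open>d k\<close> for all \<open>k\<close> need not have a common finite
  support, but those at the finitely many variables of \<open>p\<close> do.\<close>

lemma fin_supp_sat:
  assumes "\<And>k. d k \<in> elems"
  shows "fin_supp (\<lambda>s. sat M (\<lambda>k. d k s) p)"
proof -
  obtain F where "finite F" "F \<subseteq> I" "\<forall>k\<in>fm_vars p. depends_on F (d k)"
    using fin_supp_finite[OF finite_fm_vars, of p d] assms elems_fin_supp by blast
  then show ?thesis by (auto intro: fin_suppI depends_on_sat)
qed

text \<open>Los's theorem. On finitely supported predicates \<open>almost\<close> commutes with
  negation and conjunction; the existential quantifier requires a finitely supported function of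
  witnesses.\<close>

lemma sat_power:
  assumes "is_fm L p" and "\<And>k. d k \<in> elems"
  shows "sat power (\<lambda>k. cls (d k)) p \<longleftrightarrow> almost (\<lambda>s. sat M (\<lambda>k. d k s) p)"
  using assms
proof (induction p arbitrary: d)
  case (Eq s t)
  then show ?case using eval_power[of s d] eval_power[of t d] by (simp add: cls_eq_iff)
next
  case (Rel r ts)
  let ?g = "\<lambda>t s. eval M (\<lambda>k. d k s) t"
  have g: "?g t \<in> elems" "eval power (\<lambda>k. cls (d k)) t = cls (?g t)" if "t \<in> set ts" for t
    using Rel that eval_power[of t d] by auto
  have m: "map (eval power (\<lambda>k. cls (d k))) ts = map (\<lambda>t. cls (?g t)) ts" using g by simp
  have "sat power (\<lambda>k. cls (d k)) (Rel r ts) \<longleftrightarrow> almost (\<lambda>s. rel_int M r (map (\<lambda>t. ?g t s) ts))"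
    unfolding sat.simps m by (rule rel_int_power[OF g(1)])
  then show ?case by simp
next
  case (Neg p)
  then show ?case using almost_not[OF fin_supp_sat, of d p] by simp
next
  case (Conj p q)
  then show ?case using almost_conj[OF fin_supp_sat fin_supp_sat, of d d p q] by simp
next
  case (Ex n p)
  let ?e = "\<lambda>f k. if k = n then f else d k"
  have e: "?e f k \<in> elems" if "f \<in> elems" for f k using that Ex.prems by simp
  have upd: "(\<lambda>k. cls (d k))(n := cls f) = (\<lambda>k. cls (?e f k))"
    "(\<lambda>k. d k s)(n := f s) = (\<lambda>k. ?e f k s)" for f s by auto
  have IH: "sat power ((\<lambda>k. cls (d k))(n := cls f)) p \<longleftrightarrow> almost (\<lambda>s. sat M ((\<lambda>k. d k s)(n := f s)) p)"
    if "f \<in> elems" for f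
    unfolding upd using e[OF that] Ex.prems by (intro Ex.IH) auto
  have fin1: "fin_supp (\<lambda>s. sat M ((\<lambda>k. d k s)(n := f s)) p)" if "f \<in> elems" for f
    unfolding upd using e[OF that] by (rule fin_supp_sat)
  have fin2: "fin_supp (\<lambda>s. \<exists>a\<in>universe M. sat M ((\<lambda>k. d k s)(n := a)) p)"
    using fin_supp_sat[of d "Ex n p"] Ex.prems by simp
  show ?case
  proof
    assume "sat power (\<lambda>k. cls (d k)) (Ex n p)"
    then obtain f where f: "f \<in> elems" and "almost (\<lambda>s. sat M ((\<lambda>k. d k s)(n := f s)) p)"
      using IH by auto
    then have "almost (\<lambda>s. \<exists>a\<in>universe M. sat M ((\<lambda>k. d k s)(n := a)) p)"
      using fin1 fin2 elems_universe by (elim almost_mono) blast+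
    then show "almost (\<lambda>s. sat M (\<lambda>k. d k s) (Ex n p))" by simp
  next
    assume *: "almost (\<lambda>s. sat M (\<lambda>k. d k s) (Ex n p))"
    obtain m where m: "m \<in> universe M" using M by (auto simp: is_struct_def)
    \<comment> \<open>The witness is chosen from the predicate \<open>W s\<close> alone, so that
      \<open>f\<close> inherits the support of the parameters; the default \<open>m\<close> keeps
      its values in the universe where no witness exists.\<close>
    define W where "W s a \<longleftrightarrow> a \<in> universe M \<and> sat M ((\<lambda>k. d k s)(n := a)) p" for s a
    define f where "f s = (if \<exists>a. W s a then SOME a. W s a else m)" for s
    have W: "W s (f s)" if "\<exists>a. W s a" for s
      using someI_ex[OF that] that by (simp add: f_def)
    have fM: "f s \<in> universe M" for s
      using W[of s] m by (cases "\<exists>a. W s a") (auto simp: f_def W_def)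
    obtain F where F: "finite F" "F \<subseteq> I" "\<forall>k\<in>fm_vars p. depends_on F (d k)"
      using fin_supp_finite[OF finite_fm_vars, of p d] Ex.prems elems_fin_supp by blast
    have "depends_on F f"
      unfolding depends_on_def
    proof (intro allI impI)
      fix s t :: "'i \<Rightarrow> nat" assume st: "\<forall>i\<in>F. s i = t i"
      have "sat M ((\<lambda>k. d k s)(n := a)) p = sat M ((\<lambda>k. d k t)(n := a)) p" for a
        by (rule sat_cong_vars) (use F(3) st in \<open>auto intro: depends_onD\<close>)
      \<comment> \<open>Equal predicates give equal choices, hence \<open>F\<close> supports
        \<open>f\<close>.\<close>
      then have "W s = W t" by (auto simp: W_def fun_eq_iff)
      then show "f s = f t" by (simp add: f_def)
    qed
    then have f: "f \<in> elems" using F fM by (auto simp: elems_def intro: fin_suppI)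
    have "almost (\<lambda>s. sat M ((\<lambda>k. d k s)(n := f s)) p)"
    proof (rule almost_mono)
      show "almost (\<lambda>s. \<exists>a\<in>universe M. sat M ((\<lambda>k. d k s)(n := a)) p)" using * by simp
      show "sat M ((\<lambda>k. d k s)(n := f s)) p" if "\<exists>a\<in>universe M. sat M ((\<lambda>k. d k s)(n := a)) p" for s
        using W[of s] that by (auto simp: W_def)
    qed (use fin1[OF f] fin2 in auto)
    then show "sat power (\<lambda>k. cls (d k)) (Ex n p)" using IH[OF f] f by auto
  qed
qed

text \<open>Los's theorem for constant functions: an assignment in the copy of \<open>M\<close> is
  also one of classes of constants, and \<open>almost\<close> of a constant predicate is its truth
  value in \<open>M\<close>.\<close>

lemma elem_extension_power: "elem_extension L (struct_copy Inl M) power"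
proof -
  have inj: "inj_on Inl (universe M)" by simp
  have inv: "inv_into (universe M) Inl (Inl m) = m" if "m \<in> universe M" for m
    using inv_into_f_f[OF inj that] .
  have univ: "Inl ` universe M \<subseteq> cls ` elems"
  proof
    fix x :: "('i, 'm) ambient" assume "x \<in> Inl ` universe M"
    then obtain m where "m \<in> universe M" "x = cls (\<lambda>_. m)" by (auto simp: cls_const)
    then show "x \<in> cls ` elems" by simp
  qed
  have rep_inv: "map (\<lambda>x. rep x s) xs = map (inv_into (universe M) Inl) xs"
    "map (inv_into (universe M) Inl) xs \<in> tuples (universe M) n"
    if "xs \<in> tuples (Inl ` universe M) n" for xs :: "('i, 'm) ambient list" and s n
    using that inv by (auto simp: tuples_def subset_iff)
  have clos: "fun_int M f xs \<in> universe M" if "f \<in> fun_syms L" "xs \<in> tuples (universe M) (fun_arity L f)" for f xs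
    using M that by (auto simp: is_struct_def)
  have copy: "is_struct L (struct_copy Inl M :: ('f, 'r, ('i, 'm) ambient) fo_struct)"
    using M clos rep_inv(2) by (auto simp: is_struct_def)
  have "substruct L (struct_copy Inl M) power"
    unfolding substruct_def
  proof (intro conjI ballI)
    fix f and xs :: "('i, 'm) ambient list"
    assume f: "f \<in> fun_syms L" and "xs \<in> tuples (universe (struct_copy Inl M)) (fun_arity L f)"
    then have xs: "xs \<in> tuples (Inl ` universe M) (fun_arity L f)" by simp
    show "fun_int (struct_copy Inl M) f xs = fun_int power f xs"
      unfolding struct_copy_simps power_simps rep_inv(1)[OF xs]
      using cls_const[OF clos[OF f rep_inv(2)[OF xs]]] by simp
  next
    fix r and xs :: "('i, 'm) ambient list"
    assume "xs \<in> tuples (universe (struct_copy Inl M)) (rel_arity L r)"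
    then have xs: "xs \<in> tuples (Inl ` universe M) (rel_arity L r)" by simp
    show "rel_int (struct_copy Inl M) r xs = rel_int power r xs"
      unfolding struct_copy_simps power_simps rep_inv(1)[OF xs] by simp
  qed (use copy is_struct_power univ in auto)
  moreover have "sat (struct_copy Inl M) e p \<longleftrightarrow> sat power e p"
    if p: "is_fm L p" and e: "range e \<subseteq> universe (struct_copy Inl M)" for p and e :: "nat \<Rightarrow> ('i, 'm) ambient"
  proof -
    have "\<forall>k. \<exists>m\<in>universe M. e k = Inl m" using e by auto
    then obtain d where d: "\<And>k. d k \<in> universe M" "\<And>k. e k = Inl (d k)" by metis
    have "e = (\<lambda>k. Inl (d k))" "e = (\<lambda>k. cls (\<lambda>_. d k))" using d by (auto simp: cls_const)
    then show ?thesis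
      using sat_struct_copy[OF M inj p, of d] sat_power[OF p, of "\<lambda>k _. d k"] d(1) by auto
  qed
  ultimately show ?thesis by (auto simp: elem_extension_def)
qed


section \<open>The action of the order automorphisms\<close>

text \<open>Precomposition turns coordinate \<open>i\<close> into coordinate
  \<open>\<alpha> i\<close> and gives a left action. Since \<open>\<alpha>\<close> carries
  information on \<open>I\<close> only, the laws below concern functions that depend on
  \<open>I\<close>.\<close>

definition act :: "('i \<Rightarrow> 'i) \<Rightarrow> (('i \<Rightarrow> nat) \<Rightarrow> 'b) \<Rightarrow> ('i \<Rightarrow> nat) \<Rightarrow> 'b" where
  "act \<alpha> f = (\<lambda>s. f (s \<circ> \<alpha>))"

definition hat :: "('i \<Rightarrow> 'i) \<Rightarrow> ('i, 'm) ambient \<Rightarrow> ('i, 'm) ambient" where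
  "hat \<alpha> = (\<lambda>x\<in>universe power. cls (act \<alpha> (rep x)))"

lemma order_automorphismD:
  assumes "\<alpha> \<in> order_automorphisms I less"
  shows "inj_on \<alpha> I" "\<alpha> ` I = I" "i \<in> I \<Longrightarrow> \<alpha> i \<in> I"
    "i \<in> I \<Longrightarrow> j \<in> I \<Longrightarrow> (i, j) \<in> less \<Longrightarrow> (\<alpha> i, \<alpha> j) \<in> less"
  using assms by (auto simp: order_automorphisms_def Bij_def bij_betw_def)

lemma fin_supp_depends_on: "fin_supp f \<Longrightarrow> depends_on I f"
  by (auto simp: fin_supp_def intro: depends_on_mono)

lemma depends_on_act: "depends_on A f \<Longrightarrow> depends_on (\<alpha> ` A) (act \<alpha> f)"
  unfolding depends_on_def act_def by simp

text \<open>Updating at \<open>\<alpha> i\<close> and then precomposing with \<open>\<alpha>\<close>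
  is, on \<open>I\<close>, precomposing and then updating at \<open>i\<close>; this uses
  injectivity.\<close>

lemma iter_eventually_act:
  assumes "inj_on \<alpha> I" "depends_on I P" "set xs \<subseteq> I"
  shows "iter_eventually U (map \<alpha> xs) (act \<alpha> P) \<longleftrightarrow> iter_eventually U xs P"
  using assms(2,3)
proof (induction xs arbitrary: P)
  case Nil
  then show ?case by (simp add: act_def comp_def)
next
  case (Cons i xs)
  have "act \<alpha> P (s(\<alpha> i := k)) = act \<alpha> (\<lambda>s. P (s(i := k))) s" for s k
    unfolding act_def
    by (rule depends_onD[OF Cons.prems(1)]) (use Cons.prems(2) assms(1) in \<open>auto dest: inj_onD\<close>)
  moreover have "depends_on I (\<lambda>s. P (s(i := k)))" for k
    by (rule depends_on_mono[OF depends_on_upd[OF Cons.prems(1)]]) auto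
  ultimately show ?case using Cons by simp
qed

lemma sorted_less_map:
  assumes "\<alpha> \<in> order_automorphisms I less" "sorted_less xs" "set xs \<subseteq> I"
  shows "sorted_less (map \<alpha> xs)"
  using assms(2,3) by (induction xs) (auto intro: order_automorphismD[OF assms(1)])

lemma fin_supp_act:
  assumes \<alpha>: "\<alpha> \<in> order_automorphisms I less" and "fin_supp f"
  shows "fin_supp (act \<alpha> f)"
proof -
  obtain F where F: "finite F" "F \<subseteq> I" "depends_on F f" using assms(2) by (auto simp: fin_supp_def)
  then show ?thesis
    using order_automorphismD(3)[OF \<alpha>] by (intro fin_suppI[of "\<alpha> ` F"] depends_on_act) auto
qed

text \<open>An order automorphism keeps lists sorted, so the permuted predicate is tested along the
  permuted list with its quantifiers in the same order.\<close>

lemma almost_act: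
  assumes \<alpha>: "\<alpha> \<in> order_automorphisms I less" and P: "fin_supp P"
  shows "almost (act \<alpha> P) \<longleftrightarrow> almost P"
proof -
  obtain xs where xs: "sorted_less xs" "set xs \<subseteq> I" "depends_on (set xs) P"
    using fin_supp_sorted[OF P P] .
  have "almost (act \<alpha> P) \<longleftrightarrow> iter_eventually U (map \<alpha> xs) (act \<alpha> P)"
    using xs depends_on_act[OF xs(3), of \<alpha>] order_automorphismD(3)[OF \<alpha>]
    by (intro almost_iff sorted_less_map[OF \<alpha>]) auto
  also have "\<dots> \<longleftrightarrow> iter_eventually U xs P"
    using order_automorphismD(1)[OF \<alpha>] fin_supp_depends_on[OF P] xs(2) by (rule iter_eventually_act)
  also have "\<dots> \<longleftrightarrow> almost P" using almost_iff[OF xs] by simp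
  finally show ?thesis .
qed

lemma act_elems: "\<alpha> \<in> order_automorphisms I less \<Longrightarrow> f \<in> elems \<Longrightarrow> act \<alpha> f \<in> elems"
  using fin_supp_act[of \<alpha> f] by (auto simp: elems_def act_def)

lemma almost_act_eq:
  assumes "\<alpha> \<in> order_automorphisms I less" "fin_supp f" "fin_supp g"
  shows "almost (\<lambda>s. act \<alpha> f s = act \<alpha> g s) \<longleftrightarrow> almost (\<lambda>s. f s = g s)"
  using almost_act[OF assms(1) fin_supp_eq[OF assms(2,3)]] by (simp add: act_def)

lemma hat_cls:
  assumes \<alpha>: "\<alpha> \<in> order_automorphisms I less" and f: "f \<in> elems"
  shows "hat \<alpha> (cls f) = cls (act \<alpha> f)"
proof -
  have "almost (\<lambda>s. act \<alpha> f s = act \<alpha> (rep (cls f)) s)"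
    using almost_act_eq[OF \<alpha> elems_fin_supp[OF f] elems_fin_supp[OF rep_cls(1)[OF f]]] rep_cls(2)[OF f]
    by simp
  then have "cls (act \<alpha> f) = cls (act \<alpha> (rep (cls f)))"
    by (rule cls_eqI[OF act_elems[OF \<alpha> f] act_elems[OF \<alpha> rep_cls(1)[OF f]]])
  then show ?thesis using f by (simp add: hat_def)
qed

lemma hat_Inl:
  assumes "\<alpha> \<in> order_automorphisms I less" "m \<in> universe M"
  shows "hat \<alpha> (Inl m) = Inl m"
  using hat_cls[OF assms(1), of "\<lambda>_. m"] assms(2) by (simp add: cls_const act_def)

text \<open>\<open>compose I\<close> differs from plain composition only outside \<open>I\<close>,
  where the value of \<open>f\<close> is not affected.\<close>

lemma act_compose:
  assumes "depends_on I f"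
  shows "act (compose I \<alpha> \<beta>) f = act \<alpha> (act \<beta> f)"
  by (rule ext, unfold act_def, rule depends_onD[OF assms]) (simp add: compose_eq)

lemma act_id:
  assumes "depends_on I f"
  shows "act (\<lambda>i\<in>I. i) f = f"
  by (rule ext, unfold act_def, rule depends_onD[OF assms]) simp

section \<open>The homomorphism into the automorphism group\<close>

lemma Aut_order_simps:
  "carrier (Aut_order I less) = order_automorphisms I less"
  "\<one>\<^bsub>Aut_order I less\<^esub> = (\<lambda>i\<in>I. i)"
  "\<alpha> \<in> order_automorphisms I less \<Longrightarrow> \<beta> \<in> order_automorphisms I less \<Longrightarrow>
    \<alpha> \<otimes>\<^bsub>Aut_order I less\<^esub> \<beta> = compose I \<alpha> \<beta>"
  by (simp_all add: Aut_order_def BijGroup_def order_automorphisms_def)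

lemma compose_order_automorphisms:
  assumes "\<alpha> \<in> order_automorphisms I less" "\<beta> \<in> order_automorphisms I less"
  shows "compose I \<alpha> \<beta> \<in> order_automorphisms I less"
  using monoid.m_closed[OF group.is_monoid[OF group_Aut_order[of I less]], of \<alpha> \<beta>] assms
  by (simp add: Aut_order_simps)

lemma hat_compose:
  assumes "\<alpha> \<in> order_automorphisms I less" "\<beta> \<in> order_automorphisms I less" "x \<in> universe power"
  shows "hat (compose I \<alpha> \<beta>) x = hat \<alpha> (hat \<beta> x)"
proof -
  obtain f where f: "f \<in> elems" "x = cls f" using assms(3) by auto
  then show ?thesis
    using assms(1,2) compose_order_automorphisms[OF assms(1,2)]
    by (simp add: hat_cls act_elems act_compose fin_supp_depends_on elems_fin_supp)
qed

lemma hat_id: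
  assumes "x \<in> universe power"
  shows "hat (\<lambda>i\<in>I. i) x = x"
proof -
  obtain f where f: "f \<in> elems" "x = cls f" using assms by auto
  have "(\<lambda>i\<in>I. i) \<in> order_automorphisms I less" by (auto simp: order_automorphisms_def id_Bij)
  with f show ?thesis by (simp add: hat_cls act_id fin_supp_depends_on elems_fin_supp)
qed

lemma hat_closed:
  assumes "\<alpha> \<in> order_automorphisms I less" "x \<in> universe power"
  shows "hat \<alpha> x \<in> universe power"
  using assms by (auto simp: hat_cls act_elems)

text \<open>The action of the group inverse of \<open>\<alpha>\<close> is a two-sided inverse of
  \<open>hat \<alpha>\<close>.\<close>

lemma hat_Bij:
  assumes \<alpha>: "\<alpha> \<in> order_automorphisms I less"
  shows "hat \<alpha> \<in> Bij (universe power)"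
proof -
  interpret G: group "Aut_order I less" by (rule group_Aut_order)
  define \<beta> where "\<beta> = inv\<^bsub>Aut_order I less\<^esub> \<alpha>"
  have \<beta>: "\<beta> \<in> order_automorphisms I less"
    using G.inv_closed[of \<alpha>] \<alpha> by (simp add: \<beta>_def Aut_order_simps)
  have inv: "compose I \<alpha> \<beta> = (\<lambda>i\<in>I. i)" "compose I \<beta> \<alpha> = (\<lambda>i\<in>I. i)"
    using G.r_inv[of \<alpha>] G.l_inv[of \<alpha>] \<alpha> \<beta> by (simp_all add: Aut_order_simps flip: \<beta>_def)
  have "hat \<alpha> (hat \<beta> x) = x" "hat \<beta> (hat \<alpha> x) = x" if "x \<in> universe power" for x
    using hat_compose[OF \<alpha> \<beta> that] hat_compose[OF \<beta> \<alpha> that] hat_id[OF that] inv by auto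
  then have "bij_betw (hat \<alpha>) (universe power) (universe power)"
    using hat_closed[OF \<alpha>] hat_closed[OF \<beta>] by (intro bij_betw_byWitness[of _ "hat \<beta>"]) blast+
  then show ?thesis by (simp add: Bij_def hat_def)
qed

text \<open>\<open>act\<close> commutes with pointwise application of functions and relations, and
  \<open>almost\<close> is invariant under it.\<close>

lemma hat_automorphism:
  assumes \<alpha>: "\<alpha> \<in> order_automorphisms I less"
  shows "hat \<alpha> \<in> automorphisms L power"
proof -
  have map_hat: "map (hat \<alpha>) xs = map (\<lambda>x. cls (act \<alpha> (rep x))) xs" "\<And>x. x \<in> set xs \<Longrightarrow> rep x \<in> elems"
    "\<And>x. x \<in> set xs \<Longrightarrow> act \<alpha> (rep x) \<in> elems"
    if "xs \<in> tuples (universe power) n" for xs n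
    using that \<alpha> by (auto simp: tuples_def hat_def subset_iff intro: rep_elems act_elems)
  have "hat \<alpha> (fun_int power f xs) = fun_int power f (map (hat \<alpha>) xs)"
    if f: "f \<in> fun_syms L" and xs: "xs \<in> tuples (universe power) (fun_arity L f)" for f xs
  proof -
    have len: "length xs = fun_arity L f" using xs by (simp add: tuples_def)
    have "hat \<alpha> (fun_int power f xs) = cls (act \<alpha> (\<lambda>s. fun_int M f (map (\<lambda>x. rep x s) xs)))"
      using hat_cls[OF \<alpha> fun_elems[OF f len, of rep]] map_hat(2)[OF xs] by simp
    also have "\<dots> = cls (\<lambda>s. fun_int M f (map (\<lambda>x. act \<alpha> (rep x) s) xs))" by (simp add: act_def)
    also have "\<dots> = fun_int power f (map (hat \<alpha>) xs)"
      unfolding map_hat(1)[OF xs] by (rule fun_int_power[OF f len map_hat(3)[OF xs], symmetric])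
    finally show ?thesis .
  qed
  moreover have "rel_int power r xs \<longleftrightarrow> rel_int power r (map (hat \<alpha>) xs)"
    if xs: "xs \<in> tuples (universe power) n" for r xs n
  proof -
    have "fin_supp (\<lambda>s. rel_int M r (map (\<lambda>x. rep x s) xs))"
      using map_hat(2)[OF xs] by (intro fin_supp_comp[where h = "rel_int M r"] fin_supp_map elems_fin_supp)
    from almost_act[OF \<alpha> this]
    have "rel_int power r xs \<longleftrightarrow> almost (\<lambda>s. rel_int M r (map (\<lambda>x. act \<alpha> (rep x) s) xs))"
      by (simp add: act_def)
    also have "\<dots> \<longleftrightarrow> rel_int power r (map (hat \<alpha>) xs)"
      unfolding map_hat(1)[OF xs] by (rule rel_int_power[OF map_hat(3)[OF xs], symmetric])
    finally show ?thesis .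
  qed
  ultimately show ?thesis using hat_Bij[OF \<alpha>] unfolding automorphisms_def by blast
qed

lemma hat_hom: "hat \<in> hom (Aut_order I less) (Aut L power)"
proof (rule homI)
  fix \<alpha> assume "\<alpha> \<in> carrier (Aut_order I less)"
  then show "hat \<alpha> \<in> carrier (Aut L power)"
    using hat_automorphism by (simp add: Aut_order_simps Aut_def)
next
  fix \<alpha> \<beta> assume "\<alpha> \<in> carrier (Aut_order I less)" "\<beta> \<in> carrier (Aut_order I less)"
  then have *: "\<alpha> \<in> order_automorphisms I less" "\<beta> \<in> order_automorphisms I less"
    by (auto simp: Aut_order_simps)
  then have "\<alpha> \<otimes>\<^bsub>Aut_order I less\<^esub> \<beta> = compose I \<alpha> \<beta>" by (rule Aut_order_simps(3))
  moreover have "hat (compose I \<alpha> \<beta>) = compose (universe power) (hat \<alpha>) (hat \<beta>)"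
  proof
    fix x show "hat (compose I \<alpha> \<beta>) x = compose (universe power) (hat \<alpha>) (hat \<beta>) x"
      using hat_compose[OF *] by (cases "x \<in> universe power") (simp_all add: compose_def hat_def)
  qed
  ultimately show "hat (\<alpha> \<otimes>\<^bsub>Aut_order I less\<^esub> \<beta>) = hat \<alpha> \<otimes>\<^bsub>Aut L power\<^esub> hat \<beta>"
    using hat_Bij[OF *(1)] hat_Bij[OF *(2)] by (simp add: Aut_def BijGroup_def)
qed

section \<open>Supports of fixed classes\<close>

text \<open>Finite linear orders are rigid: \<open>\<alpha>\<close> maps the increasing enumeration
  of \<open>F\<close> to an increasing enumeration of \<open>F\<close>, that is, to itself.\<close>

lemma order_automorphism_finite_invariant:
  assumes \<alpha>: "\<alpha> \<in> order_automorphisms I less" and F: "finite F" "F \<subseteq> I" "\<alpha> ` F = F" and i: "i \<in> F"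
  shows "\<alpha> i = i"
proof -
  obtain xs where xs: "sorted_less xs" "set xs = F" using sorted_wrt_exists[OF less F(1,2)] by blast
  have "map \<alpha> xs = xs"
    by (rule sorted_wrt_set_unique[OF irrefl_less trans_less]) (use xs F sorted_less_map[OF \<alpha>] in auto)
  then show ?thesis using i xs(2) by (metis map_eq_conv map_ident)
qed

text \<open>The contrapositive of moving every new element. The least support of the class is found
  as one of least cardinality, which turns out to be invariant under
  \<open>\<alpha>\<close>.\<close>

lemma hat_moves:
  assumes \<alpha>: "\<alpha> \<in> order_automorphisms I less" and fpf: "fixed_point_free I \<alpha>"
    and x: "x \<in> universe power" and fixed: "hat \<alpha> x = x"
  shows "x \<in> Inl ` universe M"
proof -
  obtain f where f: "f \<in> elems" "x = cls f" using x by auto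
  \<comment> \<open>\<open>S F\<close> says that the class of \<open>f\<close> has a representative
    supported by \<open>F\<close>. Its values are not confined to the universe of \<open>M\<close>;
    this is recovered for the constant at the end.\<close>
  define S where "S F \<longleftrightarrow> finite F \<and> F \<subseteq> I \<and> (\<exists>g. depends_on F g \<and> almost (\<lambda>s. g s = f s))" for F
  have "\<exists>F. S F" using f(1) by (auto simp: S_def elems_def fin_supp_def intro!: exI[of _ f])
  then obtain F where F: "S F" and min: "\<And>G. S G \<Longrightarrow> card F \<le> card G"
    using ex_has_least_nat[of S _ card] by blast
  then obtain g where finF: "finite F" and FI: "F \<subseteq> I" and g: "depends_on F g"
    and gf: "almost (\<lambda>s. g s = f s)"
    by (auto simp: S_def)
  have fsf: "fin_supp f" "fin_supp (act \<alpha> f)" using f(1) \<alpha> elems_fin_supp act_elems by auto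
  have fsg: "fin_supp g" using finF FI g by (rule fin_suppI)
  note fsg = fsg fin_supp_act[OF \<alpha> fsg]
  have ff: "almost (\<lambda>s. act \<alpha> f s = f s)"
    using fixed f \<alpha> by (simp add: hat_cls act_elems cls_eq_iff)
  have "almost (\<lambda>s. act \<alpha> g s = act \<alpha> f s)" using almost_act_eq[OF \<alpha> fsg(1) fsf(1)] gf by simp
  then have gg: "almost (\<lambda>s. act \<alpha> g s = f s)" by (rule almost_eq_trans[OF _ ff fsg(2) fsf(2,1)])
  have \<alpha>F: "finite (\<alpha> ` F)" "\<alpha> ` F \<subseteq> I" "depends_on (\<alpha> ` F) (act \<alpha> g)"
    using finF FI g order_automorphismD(3)[OF \<alpha>] by (auto intro: depends_on_act)
  obtain xs where xs: "sorted_less xs" "set xs = F \<union> \<alpha> ` F"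
    using sorted_wrt_exists[OF less, of "F \<union> \<alpha> ` F"] finF FI \<alpha>F by auto
  have dep: "depends_on (set xs) g" "depends_on (set xs) (act \<alpha> g)"
    using g \<alpha>F(3) xs(2) by (auto intro: depends_on_mono)
  have "almost (\<lambda>s. g s = act \<alpha> g s)"
    using gg almost_eq_sym[of f "act \<alpha> g"] by (intro almost_eq_trans[OF gf _ fsg(1) fsf(1) fsg(2)]) simp
  then have "iter_eventually U xs (\<lambda>s. g s = act \<alpha> g s)"
    using almost_iff[OF xs(1) _ depends_on_comp2[OF dep]] xs(2) FI \<alpha>F(2) by auto
  \<comment> \<open>The two representatives agree almost everywhere, so the class has a third one
    supported by the intersection.\<close>
  then obtain h where h: "depends_on (F \<inter> \<alpha> ` F) h" and hg: "iter_eventually U xs (\<lambda>s. h s = g s)"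
    using iter_eventually_eq_common_support[OF U sorted_wrt_irrefl_distinct[OF irrefl_less xs(1)] _ g \<alpha>F(3)] xs(2)
    by auto
  have "depends_on (set xs) (\<lambda>s. h s = g s)"
    by (rule depends_on_comp2[OF depends_on_mono[OF h] dep(1)]) (use xs(2) in auto)
  then have "almost (\<lambda>s. h s = g s)" using hg xs FI \<alpha>F(2) by (subst almost_iff[of xs]) auto
  moreover have "fin_supp h" using h finF FI by (auto intro: fin_suppI)
  ultimately have "almost (\<lambda>s. h s = f s)" by (rule almost_eq_trans[OF _ gf _ fsg(1) fsf(1)])
  then have "S (F \<inter> \<alpha> ` F)" using h finF FI by (auto simp: S_def)
  \<comment> \<open>Minimality makes the intersection all of \<open>F\<close>; as
    \<open>\<alpha>\<close> preserves cardinality, the inclusion of \<open>F\<close> in its image is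
    an equality.\<close>
  from min[OF this] have "F \<inter> \<alpha> ` F = F" using finF by (intro card_seteq) auto
  then have "F \<subseteq> \<alpha> ` F" by blast
  moreover have "card (\<alpha> ` F) = card F"
    by (rule card_image[OF inj_on_subset[OF order_automorphismD(1)[OF \<alpha>] FI]])
  ultimately have "\<alpha> ` F = F" using \<alpha>F(1) by (metis card_subset_eq)
  then have "F = {}"
    using order_automorphism_finite_invariant[OF \<alpha> finF FI] fpf FI by (auto simp: fixed_point_free_def)
  then have "g = (\<lambda>_. g (\<lambda>_. 0))" using g depends_on_empty by (intro ext) blast
  then obtain c where c: "g = (\<lambda>_. c)" by blast
  then have cf: "almost (\<lambda>s. c = f s)" using gf by simp
  \<comment> \<open>The constant equals \<open>f s\<close> for some \<open>s\<close>, hence lies in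
    the universe.\<close>
  then have "c \<in> universe M" using almost_ex[OF cf] elems_universe[OF f(1)] by auto
  moreover from this have "cls (\<lambda>_. c) = cls f" using cf f(1) by (intro cls_eqI) auto
  ultimately show ?thesis using f(2) cls_const by (metis imageI)
qed


section \<open>Coordinate functions\<close>

lemma coordinate_elems:
  assumes "range \<iota> \<subseteq> universe M" "i \<in> I"
  shows "(\<lambda>s. \<iota> (s i)) \<in> elems"
proof -
  have "depends_on {i} (\<lambda>s. \<iota> (s i))" by (simp add: depends_on_def)
  then show ?thesis using assms by (auto simp: elems_def intro: fin_suppI[of "{i}"])
qed

text \<open>Otherwise \<open>U\<close> would concentrate on the single number that
  \<open>\<iota>\<close> sends to \<open>m\<close>, which a free ultrafilter cannot do.\<close>

lemma coordinate_not_const: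
  assumes "inj \<iota>" "i \<in> I"
  shows "\<not> almost (\<lambda>s. \<iota> (s i) = m)"
proof
  assume a: "almost (\<lambda>s. \<iota> (s i) = m)"
  then obtain s where s: "\<iota> (s i) = m" using almost_ex by blast
  have "depends_on {i} (\<lambda>s. \<iota> (s i) = m)" by (simp add: depends_on_def)
  then have "\<forall>\<^sub>F k in U. \<iota> k = m" using a assms(2) by (subst (asm) almost_iff[of "[i]"]) auto
  then have "\<forall>\<^sub>F k in U. k = s i" by (rule eventually_mono) (use s assms(1) in \<open>auto dest: injD\<close>)
  then show False using free_ultrafilter_neq[OF U, of "s i"] free_ultrafilter_not[OF U] by blast
qed

text \<open>If \<open>i\<close> precedes \<open>j\<close>, almost every \<open>k\<close> would equal
  almost every \<open>l\<close>; fixing one such \<open>k\<close> contradicts freeness. The other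
  order follows by symmetry.\<close>

lemma coordinate_neq:
  assumes "inj \<iota>" "i \<in> I" "j \<in> I" "almost (\<lambda>s. \<iota> (s i) = \<iota> (s j))"
  shows "i = j"
proof (rule ccontr)
  assume "i \<noteq> j"
  have "almost (\<lambda>s. s i = s j)" using assms(1,4) by (simp add: inj_eq)
  moreover have False if "(i, j) \<in> less" "i \<noteq> j" "i \<in> I" "j \<in> I" "almost (\<lambda>s. s i = s j)" for i j
  proof -
    have "depends_on {i, j} (\<lambda>s. s i = s j)" by (simp add: depends_on_def)
    then have "\<forall>\<^sub>F k in U. \<forall>\<^sub>F l in U. k = l"
      using that by (subst (asm) almost_iff[of "[i, j]"]) auto
    from eventually_happens[OF this] obtain k where "\<forall>\<^sub>F l in U. k = l"
      using U unfolding free_ultrafilter_def by blast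
    then show False using free_ultrafilter_neq[OF U, of k] free_ultrafilter_not[OF U, of "\<lambda>l. k = l"]
      by (simp add: eq_commute)
  qed
  moreover have "(i, j) \<in> less \<or> (j, i) \<in> less"
    using less \<open>i \<noteq> j\<close> assms(2,3) by (auto simp: strict_linear_order_on_def total_on_def)
  ultimately show False using \<open>i \<noteq> j\<close> assms(2,3) almost_eq_sym[of "\<lambda>s. s i" "\<lambda>s. s j"] by metis
qed

lemma proper_elem_extension_power:
  assumes "infinite (universe M)" "I \<noteq> {}"
  shows "proper_elem_extension L (struct_copy Inl M) power"
proof -
  obtain \<iota> :: "nat \<Rightarrow> 'm" where \<iota>: "inj \<iota>" "range \<iota> \<subseteq> universe M"
    using infinite_countable_subset[OF assms(1)] by blast
  obtain i where i: "i \<in> I" using assms(2) by blast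
  have "cls (\<lambda>s. \<iota> (s i)) \<in> universe power" using coordinate_elems[OF \<iota>(2) i] by simp
  moreover have "cls (\<lambda>s. \<iota> (s i)) \<notin> Inl ` universe M"
    using coordinate_not_const[OF \<iota>(1) i] by (auto simp: cls_def)
  ultimately have "universe (struct_copy Inl M) \<noteq> universe power" by (metis struct_copy_simps(1))
  then show ?thesis using elem_extension_power by (simp add: proper_elem_extension_def)
qed

text \<open>\<open>hat \<alpha>\<close> takes the class of coordinate \<open>i\<close> to that of
  coordinate \<open>\<alpha> i\<close>, and different coordinates have different classes.\<close>

lemma hat_inj:
  assumes "infinite (universe M)"
  shows "inj_on hat (order_automorphisms I less)"
proof (rule inj_onI)
  fix \<alpha> \<beta> assume \<alpha>: "\<alpha> \<in> order_automorphisms I less" and \<beta>: "\<beta> \<in> order_automorphisms I less"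
    and eq: "hat \<alpha> = hat \<beta>"
  obtain \<iota> :: "nat \<Rightarrow> 'm" where \<iota>: "inj \<iota>" "range \<iota> \<subseteq> universe M"
    using infinite_countable_subset[OF assms] by blast
  have "\<alpha> i = \<beta> i" if i: "i \<in> I" for i
  proof -
    let ?f = "\<lambda>s. \<iota> (s i)"
    have f: "?f \<in> elems" using \<iota>(2) i by (rule coordinate_elems)
    have "cls (act \<alpha> ?f) = cls (act \<beta> ?f)" using hat_cls[OF \<alpha> f] hat_cls[OF \<beta> f] eq by simp
    then have "almost (\<lambda>s. act \<alpha> ?f s = act \<beta> ?f s)"
      using cls_eq_iff[OF act_elems[OF \<alpha> f] act_elems[OF \<beta> f]] by simp
    then show ?thesis
      using coordinate_neq[OF \<iota>(1)] order_automorphismD(3)[OF \<alpha> i] order_automorphismD(3)[OF \<beta> i]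
      by (simp add: act_def)
  qed
  moreover have "\<alpha> \<in> extensional I" "\<beta> \<in> extensional I"
    using \<alpha> \<beta> by (auto simp: order_automorphisms_def Bij_def)
  ultimately show "\<alpha> = \<beta>" by (intro extensionalityI) auto
qed

end

theorem theorem2p4:
  fixes L :: "('f, 'r) language"
    and M :: "('f, 'r, 'm) fo_struct"
    and I :: "'i set"
    and less :: "'i rel"
  assumes "is_struct L M"
    and "infinite (universe M)"
    and "strict_linear_order_on I less"
    and "I \<noteq> {}"
  shows "\<exists>(N :: ('f, 'r, ('i, 'm) ambient) fo_struct) hat.
           proper_elem_extension L (struct_copy Inl M) N \<and>
           hat \<in> mon (Aut_order I less) (Aut L N) \<and>
           (\<forall>\<alpha>\<in>carrier (Aut_order I less). fixed_point_free I \<alpha> \<longrightarrow>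
              (\<forall>x\<in>universe N - universe (struct_copy Inl M). hat \<alpha> x \<noteq> x) \<and>
              (\<forall>x\<in>universe (struct_copy Inl M). hat \<alpha> x = x))"
proof -
  \<comment> \<open>Any free ultrafilter on the naturals serves; the extension is then
    \<open>power\<close> and the embedding is \<open>hat\<close>.\<close>
  obtain U :: "nat filter" where "free_ultrafilter U" using free_ultrafilter_exists by auto
  with assms interpret iterated_ultrapower L M I less U by unfold_locales
  have "hat \<in> mon (Aut_order I less) (Aut L power)"
    using hat_hom hat_inj[OF assms(2)] by (simp add: mon_def Aut_order_simps)
  moreover have "hat \<alpha> x \<noteq> x"
    if "\<alpha> \<in> order_automorphisms I less" "fixed_point_free I \<alpha>"
      "x \<in> universe power - universe (struct_copy Inl M)" for \<alpha> x
    using hat_moves[OF that(1,2), of x] that(3) by auto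
  moreover have "hat \<alpha> x = x"
    if "\<alpha> \<in> order_automorphisms I less" "x \<in> universe (struct_copy Inl M)" for \<alpha> x
    using that hat_Inl by auto
  ultimately show ?thesis
    using proper_elem_extension_power[OF assms(2,4)] unfolding Aut_order_simps by blast
qed

end
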